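(* Let $R$ be a von Neumann regular unital ring. There is a natural isomorphism of partially ordered abelian monoids with order-unit $$\widetilde{\Psi}: (\mathrm{W}_{\mathrm{M}}(R), \preceq_{\mathrm{M}}, \langle 1\rangle_{\mathrm{M}}) \rightarrow (\mathrm{V}_{\mathrm{M}}(R), \preceq_{\mathrm{M}}, \langle {}_RR\rangle_{\mathrm{M}})$$ given by $\widetilde{\Psi}(\langle A\rangle_{\mathrm{M}})=\langle R^n A\rangle_{\mathrm{M}}$ for every $A\in M_{n, m}(R)$ (and all $n,m$).
   Context: All unital rings are nonzero. A unital ring $R$ is von Neumann regular if for every $a\in R$ there is $b\in R$ with $aba=a$. $M(R)$ is the set of all rectangular matrices over $R$; elements of $R^n$ are row vectors, and for $A\in M_{n,m}(R)$, $R^nA=\{xA:x\in R^n\}$ is a left $R$-submodule of $R^m$ (for von Neumann regular $R$ it is finitely presented). $\mathrm{diag}(A,B)$ is the block diagonal matrix. Matrix Malcolmson semigroup. For $A,B\in M(R)$ write $A\lesssim B$ if either $A=CBD$ for some $C,D\in M(R)$, or $B=\begin{bmatrix}C&E\\0&D\end{bmatrix}$ and $A=\begin{bmatrix}C&0\\0&D\end{bmatrix}$ for some $C,D,E\in M(R)$. Write $A\preceq_{\mathrm{M}}B$ if there is a finite chain $A=A_1\lesssim\dots\lesssim A_n=B$ in $M(R)$, and $A\sim_{\mathrm{M}}B$ if $A\preceq_{\mathrm{M}}B\preceq_{\mathrm{M}}A$. $\mathrm{W}_{\mathrm{M}}(R)=M(R)/\sim_{\mathrm{M}}$, with classes $\langle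 A\rangle_{\mathrm{M}}$, is an abelian monoid under $\langle A\rangle_{\mathrm{M}}+\langle B\rangle_{\mathrm{M}}=\langle\mathrm{diag}(A,B)\rangle_{\mathrm{M}}$, partially ordered by $\preceq_{\mathrm{M}}$, with order-unit $\langle1\rangle_{\mathrm{M}}$. Finitely presented module Malcolmson semigroup. For finitely presented left $R$-modules $\mathcal{M},\mathcal{N}$ write $\mathcal{M}\lesssim\mathcal{N}$ if one can write $\mathcal{N}=\mathcal{N}_1\oplus\mathcal{N}_2$ such that there is an exact sequence $\mathcal{N}_1\to\mathcal{M}\to\mathcal{N}_2\to0$. Write $\mathcal{M}\preceq_{\mathrm{M}}\mathcal{N}$ if there is a finite chain $\mathcal{M}=\mathcal{M}_1\lesssim\dots\lesssim\mathcal{M}_n=\mathcal{N}$ of finitely presented left $R$-modules, and $\mathcal{M}\sim_{\mathrm{M}}\mathcal{N}$ if $\mathcal{M}\preceq_{\mathrm{M}}\mathcal{N}\preceq_{\mathrm{M}}\mathcal{M}$. $\mathrm{V}_{\mathrm{M}}(R)$ is the set of $\sim_{\mathrm{M}}$-classes $\langle\mathcal{M}\rangle_{\mathrm{M}}$ of finitely presented left $R$-modules, an abelian monoid under $\langle\mathcal{M}\rangle_{\mathrm{M}}+\langle\mathcal{N}\rangle_{\mathrm{M}}=\langle\mathcal{M}\oplus\mathcal{N}\rangle_{\mathrm{M}}$, partially ordered by $\preceq_{\mathrm{M}}$, with order-unit $\langle{}_RR\rangle_{\mathrm{M}}$. An isomorphism of partially ordered abelian monoids with order-unit is a monoid isomorphism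 that is an order isomorphism (preserves and reflects the order) and maps the order-unit to the order-unit. *)

theory Defs
  imports "Jordan_Normal_Form.Matrix" "HOL-Algebra.Coset" "HOL-Algebra.AbelCoset"
begin

definition von_neumann_regular :: "'a::ring_1 itself \<Rightarrow> bool" where
  "von_neumann_regular _ \<longleftrightarrow> (\<forall>a::'a. \<exists>b. a * b * a = a)"


section \<open>Partially ordered abelian monoids with order-unit\<close>

text \<open>The monoid operation, written additively on paper, is the multiplicative
  \<^const>\<open>mult\<close> of the underlying monoid record; thus \<open>n\<close> times \<open>u\<close> is the power \<open>u [^] n\<close>.\<close>

record 'x po_monoid = "'x monoid" +
  po_le :: "'x \<Rightarrow> 'x \<Rightarrow> bool"
  po_unit :: "'x"

locale po_comm_monoid = comm_monoid G for G :: "'x po_monoid" (structure) +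
  assumes partial_order:
      "partial_order_on (carrier G) {(x, y). x \<in> carrier G \<and> y \<in> carrier G \<and> po_le G x y}"
    and le_translate:
      "\<lbrakk>x \<in> carrier G; y \<in> carrier G; z \<in> carrier G; po_le G x y\<rbrakk>
        \<Longrightarrow> po_le G (x \<otimes> z) (y \<otimes> z)"
    and unit_closed: "po_unit G \<in> carrier G"
    and order_unit: "x \<in> carrier G \<Longrightarrow> \<exists>n::nat. po_le G x (po_unit G [^] n)"

locale po_comm_monoid_iso = G: po_comm_monoid G + H: po_comm_monoid H
  for G :: "'x po_monoid" and H :: "'y po_monoid" and h :: "'x \<Rightarrow> 'y" +
  assumes iso: "h \<in> iso G H"
    and map_one: "h \<one>\<^bsub>G\<^esub> = \<one>\<^bsub>H\<^esub>"
    and le_iff: "\<lbrakk>x \<in> carrier G; y \<in> carrier G\<rbrakk> \<Longrightarrow> po_le G x y \<longleftrightarrow> po_le H (h x) (h y)"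
    and map_unit: "h (po_unit G) = po_unit H"


section \<open>The matrix Malcolmson semigroup\<close>

text \<open>Matrices have at least one row and one column. Admitting empty matrices would
  not change the semigroup, as they would be equivalent to the \<open>1 \<times> 1\<close> zero matrix.\<close>

definition rect_mats :: "'a mat set" where
  "rect_mats = {A. 0 < dim_row A \<and> 0 < dim_col A}"

definition block_diag :: "'a::zero mat \<Rightarrow> 'a mat \<Rightarrow> 'a mat" where
  "block_diag A B =
    four_block_mat A (0\<^sub>m (dim_row A) (dim_col B)) (0\<^sub>m (dim_row B) (dim_col A)) B"

definition mat_lesssim :: "'a::ring_1 mat \<Rightarrow> 'a mat \<Rightarrow> bool" where
  "mat_lesssim A B \<longleftrightarrow> A \<in> rect_mats \<and> B \<in> rect_mats \<and>
    ((\<exists>C\<in>rect_mats. \<exists>D\<in>rect_mats.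
        dim_col C = dim_row B \<and> dim_row D = dim_col B \<and> A = C * B * D) \<or>
     (\<exists>C\<in>rect_mats. \<exists>D\<in>rect_mats. \<exists>E\<in>carrier_mat (dim_row C) (dim_col D).
        B = four_block_mat C E (0\<^sub>m (dim_row D) (dim_col C)) D \<and> A = block_diag C D))"

definition mat_preceq :: "'a::ring_1 mat \<Rightarrow> 'a mat \<Rightarrow> bool" where
  "mat_preceq = mat_lesssim\<^sup>*\<^sup>*"

definition mat_equiv :: "('a::ring_1 mat \<times> 'a mat) set" where
  "mat_equiv = {(A, B). A \<in> rect_mats \<and> B \<in> rect_mats \<and> mat_preceq A B \<and> mat_preceq B A}"

definition mat_class :: "'a::ring_1 mat \<Rightarrow> 'a mat set" where
  "mat_class A = mat_equiv `` {A}"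

definition W_M :: "'a::ring_1 mat set po_monoid" where
  "W_M = \<lparr>carrier = rect_mats // mat_equiv,
          mult = (\<lambda>X Y. \<Union>A\<in>X. \<Union>B\<in>Y. mat_class (block_diag A B)),
          one = mat_class (0\<^sub>m 1 1),
          po_le = (\<lambda>X Y. \<exists>A\<in>X. \<exists>B\<in>Y. mat_preceq A B),
          po_unit = mat_class (1\<^sub>m 1)\<rparr>"


section \<open>Left modules\<close>

text \<open>The library's locale \<^locale>\<open>module\<close> is restricted to commutative rings of scalars,
  so left modules over a noncommutative ring are introduced here on the same record type.
  The record fields \<^const>\<open>mult\<close> and \<^const>\<open>one\<close> play no role.\<close>

locale left_module = abelian_group M
  for M :: "('a::ring_1, 'b, 'm) module_scheme" (structure) +
  assumes smult_closed: "x \<in> carrier M \<Longrightarrow> a \<odot> x \<in> carrier M"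
    and smult_l_distr: "x \<in> carrier M \<Longrightarrow> (a + b) \<odot> x = a \<odot> x \<oplus> b \<odot> x"
    and smult_r_distr: "\<lbrakk>x \<in> carrier M; y \<in> carrier M\<rbrakk> \<Longrightarrow> a \<odot> (x \<oplus> y) = a \<odot> x \<oplus> a \<odot> y"
    and smult_assoc: "x \<in> carrier M \<Longrightarrow> (a * b) \<odot> x = a \<odot> (b \<odot> x)"
    and smult_one: "x \<in> carrier M \<Longrightarrow> 1 \<odot> x = x"

definition left_hom ::
    "('a, 'b, 'm) module_scheme \<Rightarrow> ('a, 'c, 'n) module_scheme \<Rightarrow> ('b \<Rightarrow> 'c) set" where
  "left_hom M N = {h \<in> carrier M \<rightarrow> carrier N.
      (\<forall>x\<in>carrier M. \<forall>y\<in>carrier M. h (x \<oplus>\<^bsub>M\<^esub> y) = h x \<oplus>\<^bsub>N\<^esub> h y) \<and>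
      (\<forall>a. \<forall>x\<in>carrier M. h (a \<odot>\<^bsub>M\<^esub> x) = a \<odot>\<^bsub>N\<^esub> h x)}"

definition left_isomorphic ::
    "('a, 'b, 'm) module_scheme \<Rightarrow> ('a, 'c, 'n) module_scheme \<Rightarrow> bool" where
  "left_isomorphic M N \<longleftrightarrow> (\<exists>h\<in>left_hom M N. bij_betw h (carrier M) (carrier N))"

definition right_exact ::
    "('a, 'b, 'l) module_scheme \<Rightarrow> ('b \<Rightarrow> 'c) \<Rightarrow> ('a, 'c, 'm) module_scheme
      \<Rightarrow> ('c \<Rightarrow> 'd) \<Rightarrow> ('a, 'd, 'n) module_scheme \<Rightarrow> bool" where
  "right_exact L f M g N \<longleftrightarrow> f \<in> left_hom L M \<and> g \<in> left_hom M N \<and>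
      f ` carrier L = a_kernel M N g \<and> g ` carrier M = carrier N"

definition left_submodule :: "('a, 'b, 'm) module_scheme \<Rightarrow> 'b set \<Rightarrow> bool" where
  "left_submodule M S \<longleftrightarrow> subgroup S (add_monoid M) \<and> (\<forall>a. \<forall>x\<in>S. a \<odot>\<^bsub>M\<^esub> x \<in> S)"

definition internal_direct_sum :: "('a, 'b, 'm) module_scheme \<Rightarrow> 'b set \<Rightarrow> 'b set \<Rightarrow> bool" where
  "internal_direct_sum M S T \<longleftrightarrow> left_submodule M S \<and> left_submodule M T \<and>
      S <+>\<^bsub>M\<^esub> T = carrier M \<and> S \<inter> T = {\<zero>\<^bsub>M\<^esub>}"

definition direct_sum ::
    "('a, 'b, 'm) module_scheme \<Rightarrow> ('a, 'c, 'n) module_scheme \<Rightarrow> ('a, 'b \<times> 'c) module" where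
  "direct_sum M N =
    \<lparr>carrier = carrier M \<times> carrier N, mult = undefined, one = undefined,
     zero = (\<zero>\<^bsub>M\<^esub>, \<zero>\<^bsub>N\<^esub>),
     add = (\<lambda>(x, y) (x', y'). (x \<oplus>\<^bsub>M\<^esub> x', y \<oplus>\<^bsub>N\<^esub> y')),
     smult = (\<lambda>a (x, y). (a \<odot>\<^bsub>M\<^esub> x, a \<odot>\<^bsub>N\<^esub> y))\<rparr>"

definition regular_module :: "('a::ring_1, 'a) module" where
  "regular_module =
    \<lparr>carrier = UNIV, mult = undefined, one = undefined, zero = 0, add = (+), smult = (*)\<rparr>"

definition zero_module :: "('a, unit) module" where
  "zero_module =
    \<lparr>carrier = UNIV, mult = undefined, one = undefined, zero = (), add = (\<lambda>_ _. ()),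
     smult = (\<lambda>_ _. ())\<rparr>"

text \<open>\<^term>\<open>module_vec TYPE('a::ring_1) n\<close> is the free left module of row vectors of length \<open>n\<close>.\<close>

definition fin_presented :: "('a::ring_1, 'b, 'm) module_scheme \<Rightarrow> bool" where
  "fin_presented M \<longleftrightarrow> left_module M \<and>
    (\<exists>n m f g. right_exact (module_vec TYPE('a) n) f (module_vec TYPE('a) m) g M)"

text \<open>\<^const>\<open>mult_mat_vec\<close> acts on column vectors; the product of a row vector with a
  matrix has its scalars in the other order.\<close>

definition row_vec_mult :: "'a::ring_1 vec \<Rightarrow> 'a mat \<Rightarrow> 'a vec" where
  "row_vec_mult x A = vec (dim_col A) (\<lambda>j. x \<bullet> col A j)"

text \<open>\<open>R\<^sup>n A\<close> for \<open>A\<close> with \<open>n\<close> rows and \<open>m\<close> columns, as a submodule of \<open>R\<^sup>m\<close>.\<close>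

definition row_module :: "'a::ring_1 mat \<Rightarrow> ('a, 'a vec) module" where
  "row_module A = (module_vec TYPE('a) (dim_col A))
      \<lparr>carrier := {row_vec_mult x A |x. x \<in> carrier_vec (dim_row A)}\<rparr>"


section \<open>The finitely presented module Malcolmson semigroup\<close>

text \<open>There is no type of all modules, so the finitely presented modules are represented by
  those with carrier a set of vectors over the ring. By \<open>fin_presented_representative\<close>
  below, every finitely presented module, on whatever type, is isomorphic to one of these,
  and \<open>mod_lesssim\<close> only depends on isomorphism classes.
  The summands in \<open>mod_lesssim\<close> are, without loss of generality, internal.\<close>

definition fp_mods :: "('a::ring_1, 'a vec) module set" where
  "fp_mods = {M. fin_presented M}"

definition mod_lesssim ::
    "('a::ring_1, 'b, 'm) module_scheme \<Rightarrow> ('a, 'c, 'n) module_scheme \<Rightarrow> bool" where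
  "mod_lesssim M N \<longleftrightarrow> fin_presented M \<and> fin_presented N \<and>
    (\<exists>S T f g. internal_direct_sum N S T \<and>
       right_exact (N\<lparr>carrier := S\<rparr>) f M g (N\<lparr>carrier := T\<rparr>))"

definition mod_preceq :: "('a::ring_1, 'a vec) module \<Rightarrow> ('a, 'a vec) module \<Rightarrow> bool" where
  "mod_preceq = mod_lesssim\<^sup>*\<^sup>*"

definition mod_equiv :: "(('a::ring_1, 'a vec) module \<times> ('a, 'a vec) module) set" where
  "mod_equiv = {(M, N). M \<in> fp_mods \<and> N \<in> fp_mods \<and> mod_preceq M N \<and> mod_preceq N M}"

text \<open>The class of a finitely presented module on an arbitrary type. For modules in
  \<^const>\<open>fp_mods\<close> it is the ordinary equivalence class, see \<open>mod_class_fp_mods\<close>.\<close>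

definition mod_class :: "('a::ring_1, 'b, 'm) module_scheme \<Rightarrow> ('a, 'a vec) module set" where
  "mod_class M = (\<Union>K\<in>{K \<in> fp_mods. left_isomorphic K M}. mod_equiv `` {K})"

definition V_M :: "('a::ring_1, 'a vec) module set po_monoid" where
  "V_M = \<lparr>carrier = fp_mods // mod_equiv,
          mult = (\<lambda>X Y. \<Union>M\<in>X. \<Union>N\<in>Y. mod_class (direct_sum M N)),
          one = mod_class zero_module,
          po_le = (\<lambda>X Y. \<exists>M\<in>X. \<exists>N\<in>Y. mod_preceq M N),
          po_unit = mod_class regular_module\<rparr>"


section \<open>Adequacy of the choice of representatives\<close>

lemma (in left_module) smult_zero: "a \<odot> \<zero> = \<zero>"
proof -
  have "a \<odot> \<zero> \<oplus> a \<odot> \<zero> = a \<odot> \<zero>"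
    using smult_r_distr[OF zero_closed zero_closed, of a] unfolding r_zero[OF zero_closed] by (rule sym)
  then show ?thesis
    using smult_closed[OF zero_closed, of a] add.r_cancel_one by blast
qed

lemma left_homD:
  assumes "h \<in> left_hom M N"
  shows "x \<in> carrier M \<Longrightarrow> h x \<in> carrier N"
    and "x \<in> carrier M \<Longrightarrow> y \<in> carrier M \<Longrightarrow> h (x \<oplus>\<^bsub>M\<^esub> y) = h x \<oplus>\<^bsub>N\<^esub> h y"
    and "x \<in> carrier M \<Longrightarrow> h (a \<odot>\<^bsub>M\<^esub> x) = a \<odot>\<^bsub>N\<^esub> h x"
  using assms by (auto simp: left_hom_def)

lemma left_hom_zero:
  assumes "left_module M" "left_module N" "h \<in> left_hom M N"
  shows "h \<zero>\<^bsub>M\<^esub> = \<zero>\<^bsub>N\<^esub>"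
proof -
  interpret M: left_module M by fact
  interpret N: left_module N by fact
  have "h \<zero>\<^bsub>M\<^esub> \<oplus>\<^bsub>N\<^esub> h \<zero>\<^bsub>M\<^esub> = h \<zero>\<^bsub>M\<^esub>"
    using left_homD(2)[OF assms(3) M.zero_closed M.zero_closed] by simp
  then show ?thesis
    using left_homD(1)[OF assms(3) M.zero_closed] N.add.r_cancel_one by blast
qed

lemma fin_presented_representative:
  fixes M :: "('a::ring_1, 'b, 'm) module_scheme"
  assumes "fin_presented M"
  shows "\<exists>K\<in>fp_mods. left_isomorphic K M"
proof -
  interpret M: left_module M using assms by (simp add: fin_presented_def)
  obtain n m f g where ex: "right_exact (module_vec TYPE('a) n) f (module_vec TYPE('a) m) g M"
    using assms by (auto simp: fin_presented_def)
  let ?F = "module_vec TYPE('a) m"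
  have g: "g \<in> left_hom ?F M" and sur: "g ` carrier ?F = carrier M"
    using ex by (auto simp: right_exact_def)
  define s where "s = inv_into (carrier ?F) g"
  have gs [simp]: "g (s x) = x" if "x \<in> carrier M" for x
    unfolding s_def using that sur by (simp add: f_inv_into_f)
  define K :: "('a, 'a vec) module" where
    "K = \<lparr>carrier = s ` carrier M, mult = undefined, one = undefined, zero = s \<zero>\<^bsub>M\<^esub>,
       add = (\<lambda>x y. s (g x \<oplus>\<^bsub>M\<^esub> g y)), smult = (\<lambda>a x. s (a \<odot>\<^bsub>M\<^esub> g x))\<rparr>"
  have Ks: "carrier K = s ` carrier M" "zero K = s \<zero>\<^bsub>M\<^esub>"
    "add K = (\<lambda>x y. s (g x \<oplus>\<^bsub>M\<^esub> g y))" "smult K = (\<lambda>a x. s (a \<odot>\<^bsub>M\<^esub> g x))"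
    by (simp_all add: K_def)
  have ag: "abelian_group K"
  proof (rule abelian_groupI)
    fix x assume "x \<in> carrier K"
    then obtain u where u: "u \<in> carrier M" "x = s u" by (auto simp: Ks)
    then have "s (\<ominus>\<^bsub>M\<^esub> u) \<in> carrier K" "s (\<ominus>\<^bsub>M\<^esub> u) \<oplus>\<^bsub>K\<^esub> x = \<zero>\<^bsub>K\<^esub>"
      by (auto simp: Ks M.l_neg)
    then show "\<exists>y\<in>carrier K. y \<oplus>\<^bsub>K\<^esub> x = \<zero>\<^bsub>K\<^esub>" by blast
  qed (auto simp: Ks M.a_ac)
  have lK: "left_module K"
    by (intro left_module.intro ag left_module_axioms.intro)
       (auto simp: Ks M.smult_closed M.smult_l_distr M.smult_r_distr M.smult_assoc M.smult_one)
  have iso: "left_isomorphic K M"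
    unfolding left_isomorphic_def
  proof
    show "g \<in> left_hom K M"
      by (auto simp: left_hom_def Ks M.smult_closed)
    show "bij_betw g (carrier K) (carrier M)"
      by (rule bij_betwI[where g = s]) (auto simp: Ks)
  qed
  have sg: "s \<circ> g \<in> left_hom ?F K"
    using left_homD[OF g] by (auto simp: left_hom_def Ks)
  have "s x = s \<zero>\<^bsub>M\<^esub> \<longleftrightarrow> x = \<zero>\<^bsub>M\<^esub>" if "x \<in> carrier M" for x
    using gs[OF that] gs[OF M.zero_closed] by metis
  then have "a_kernel ?F K (s \<circ> g) = a_kernel ?F M g"
    using left_homD(1)[OF g] by (auto simp: a_kernel_def' Ks)
  moreover have "(s \<circ> g) ` carrier ?F = carrier K"
    by (simp only: Ks sur flip: image_comp)
  ultimately have "right_exact (module_vec TYPE('a) n) f ?F (s \<circ> g) K"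
    using ex sg by (simp add: right_exact_def)
  then have "K \<in> fp_mods"
    using lK by (auto simp: fp_mods_def fin_presented_def)
  with iso show ?thesis by blast
qed

lemma left_isomorphic_sym:
  assumes "left_module M" "left_isomorphic M N"
  shows "left_isomorphic N M"
proof -
  interpret M: left_module M by fact
  obtain h where h: "h \<in> left_hom M N" and b: "bij_betw h (carrier M) (carrier N)"
    using assms by (auto simp: left_isomorphic_def)
  let ?k = "inv_into (carrier M) h"
  have bk: "bij_betw ?k (carrier N) (carrier M)"
    using b by (rule bij_betw_inv_into)
  have inv: "?k (h x) = x" if "x \<in> carrier M" for x
    using b that by (simp add: bij_betw_inv_into_left)
  have c: "carrier N = h ` carrier M" using b by (simp add: bij_betw_def)
  have "?k (h x \<oplus>\<^bsub>N\<^esub> h y) = x \<oplus>\<^bsub>M\<^esub> y" if "x \<in> carrier M" "y \<in> carrier M" for x y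
    using that inv[of "x \<oplus>\<^bsub>M\<^esub> y"] left_homD(2)[OF h] by simp
  moreover have "?k (a \<odot>\<^bsub>N\<^esub> h x) = a \<odot>\<^bsub>M\<^esub> x" if "x \<in> carrier M" for a x
    using that inv[of "a \<odot>\<^bsub>M\<^esub> x"] left_homD(3)[OF h] by (simp add: M.smult_closed)
  ultimately have "?k \<in> left_hom N M"
    by (auto simp: left_hom_def c inv)
  with bk show ?thesis by (auto simp: left_isomorphic_def)
qed

lemma left_isomorphic_imp_mod_lesssim:
  assumes "fin_presented M" "fin_presented N" "left_isomorphic M N"
  shows "mod_lesssim M N"
proof -
  interpret M: left_module M using assms by (simp add: fin_presented_def)
  interpret N: left_module N using assms by (simp add: fin_presented_def)
  obtain h where h: "h \<in> left_hom M N" and b: "bij_betw h (carrier M) (carrier N)"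
    using assms by (auto simp: left_isomorphic_def)
  have h0: "h \<zero>\<^bsub>M\<^esub> = \<zero>\<^bsub>N\<^esub>"
    by (rule left_hom_zero[OF M.left_module_axioms N.left_module_axioms h])
  have subs: "left_submodule N {\<zero>\<^bsub>N\<^esub>}" "left_submodule N (carrier N)"
    using N.add.triv_subgroup N.add.subgroup_self
    by (simp_all add: left_submodule_def N.smult_zero N.smult_closed)
  have "{\<zero>\<^bsub>N\<^esub>} <+>\<^bsub>N\<^esub> carrier N = (\<lambda>x. \<zero>\<^bsub>N\<^esub> \<oplus>\<^bsub>N\<^esub> x) ` carrier N"
    unfolding set_add_def' by blast
  also have "\<dots> = carrier N" by simp
  finally have ids: "internal_direct_sum N {\<zero>\<^bsub>N\<^esub>} (carrier N)"
    using subs by (simp add: internal_direct_sum_def)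
  have "x = \<zero>\<^bsub>M\<^esub>" if "x \<in> carrier M" "h x = \<zero>\<^bsub>N\<^esub>" for x
    using b that h0 inj_onD[of h "carrier M" x "\<zero>\<^bsub>M\<^esub>"] by (simp add: bij_betw_def)
  then have ker: "a_kernel M N h = {\<zero>\<^bsub>M\<^esub>}"
    unfolding a_kernel_def' using h0 by blast
  have "(\<lambda>_. \<zero>\<^bsub>M\<^esub>) \<in> left_hom (N\<lparr>carrier := {\<zero>\<^bsub>N\<^esub>}\<rparr>) M"
    by (simp add: left_hom_def M.smult_zero)
  then have "right_exact (N\<lparr>carrier := {\<zero>\<^bsub>N\<^esub>}\<rparr>) (\<lambda>_. \<zero>\<^bsub>M\<^esub>) M h (N\<lparr>carrier := carrier N\<rparr>)"
    using h ker bij_betw_imp_surj_on[OF b] by (simp add: right_exact_def)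
  with ids show ?thesis
    using assms unfolding mod_lesssim_def by blast
qed

lemma mod_class_fp_mods:
  assumes "M \<in> fp_mods"
  shows "mod_class M = mod_equiv `` {M}"
proof -
  have M: "fin_presented M" using assms by (simp add: fp_mods_def)
  have refl: "left_isomorphic M M"
    unfolding left_isomorphic_def
    by (rule bexI[of _ id]) (simp_all add: left_hom_def)
  have "mod_equiv `` {K} = mod_equiv `` {M}" if K: "K \<in> fp_mods" "left_isomorphic K M" for K
  proof -
    have fK: "fin_presented K" using K by (simp add: fp_mods_def)
    then have "left_isomorphic M K"
      using K left_isomorphic_sym by (auto simp: fin_presented_def)
    then have "mod_preceq K M" "mod_preceq M K"
      unfolding mod_preceq_def
      by (blast intro: r_into_rtranclp left_isomorphic_imp_mod_lesssim M fK K(2))+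
    then show ?thesis
      using K(1) assms unfolding mod_equiv_def mod_preceq_def
      by (blast intro: rtranclp_trans)
  qed
  with assms refl show ?thesis
    unfolding mod_class_def by blast
qed

end

theory Submission
  imports Defs
begin

text \<open>Rectangular matrices over a von Neumann regular ring \<open>R\<close> have quasi-inverses. Hence the diagonal
  matrix with blocks \<open>C\<close>, \<open>D\<close> already arises from the corresponding block triangular matrix by
  multiplication from both sides, and the Malcolmson preorder on matrices reduces to the relation
  \<open>A = C B D\<close>. Likewise, finitely presented modules are projective and, up to isomorphism, row spaces of
  idempotent matrices, so the Malcolmson preorder on modules reduces to being a retract. A pair of
  homomorphisms exhibiting \<open>R\<^sup>n A\<close> as a retract of \<open>R\<^sup>k B\<close> is given by matrices, and it amounts to
  an equation \<open>A = C B D\<close>; thus both semigroups are the same quotient of the set of matrices.\<close>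

text \<open>Regularity is given for elements but consumed for rectangular matrices of every shape,
  so quasi-inverses are built by clearing one entry at a time, then one column at a time, without
  passing to square matrices. The point of a quasi-inverse \<open>X\<close> of \<open>A\<close> is
  that \<open>X * A\<close> is an idempotent with the same row space as \<open>A\<close>: it selects
  preimages linearly, which lets maps be defined on products \<open>x A\<close>. Retracts replace
  direct summands because pairs of maps compose, while complements would have to be tracked through
  a chain, and because they relate modules on different types, such as a direct sum and its
  row-space model. Once equality of classes, order and addition are expressed by
  \<open>mat_le\<close> and \<open>block_diag\<close>, the monoid and order axioms are proved only
  once, over the index set of matrices. Degenerate sizes need care: matrices in the semigroup have
  positive dimensions, whereas a module may be presented by an empty idempotent; there the zero
  matrix with one entry takes over.\<close>

section \<open>Quasi-inverses of matrices\<close>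

text \<open>The inner dimensions of the factors are free variables in the premises of this rule, which makes
  the simplifier diverge.\<close>

declare assoc_mult_mat [simp del]

lemma index_mult_mat_sum:
  assumes "A \<in> carrier_mat n m" "B \<in> carrier_mat m k" "i < n" "j < k"
  shows "(A * B) $$ (i, j) = (\<Sum>s\<in>{0..<m}. A $$ (i, s) * B $$ (s, j))"
  using assms by (auto simp: scalar_prod_def)

definition regular_mat :: "'a::ring_1 mat \<Rightarrow> bool" where
  "regular_mat A \<longleftrightarrow> (\<exists>X\<in>carrier_mat (dim_col A) (dim_row A). A * X * A = A)"

text \<open>McCoy's lemma: \<open>W = A - A X A\<close> is both \<open>(1 - A X) A\<close> and \<open>A (1 - X A)\<close>, so a quasi-inverse
  \<open>Z\<close> of \<open>W\<close> gives the quasi-inverse \<open>X + (1 - X A) Z (1 - A X)\<close> of \<open>A\<close>.\<close>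

lemma regular_matI_defect:
  fixes A :: "'a::ring_1 mat"
  assumes A: "A \<in> carrier_mat n m" and X: "X \<in> carrier_mat m n"
    and reg: "regular_mat (A - A * X * A)"
  shows "regular_mat A"
proof -
  define W where "W = A - A * X * A"
  define P where "P = 1\<^sub>m n - A * X"
  define Q where "Q = 1\<^sub>m m - X * A"
  have P: "P \<in> carrier_mat n n" and Q: "Q \<in> carrier_mat m m"
    using A X by (auto simp: P_def Q_def)
  have W: "W \<in> carrier_mat n m" using A X by (auto simp: W_def)
  obtain Z where Z: "Z \<in> carrier_mat m n" and WZ: "W * Z * W = W"
    using reg W unfolding regular_mat_def W_def[symmetric] carrier_mat_def by blast
  have PA: "P * A = W"
    using A X minus_mult_distrib_mat[of "1\<^sub>m n" n n "A * X" A m] by (auto simp: P_def W_def)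
  have "A * Q = A - A * (X * A)"
    using A X mult_minus_distrib_mat[of A n m "1\<^sub>m m" m "X * A"] by (auto simp: Q_def)
  then have AQ: "A * Q = W"
    using A X by (simp add: W_def assoc_mult_mat[of A n m X n A m])
  let ?Y = "X + Q * Z * P"
  have QZ: "Q * Z \<in> carrier_mat m n" using Q Z by auto
  have QZP: "Q * Z * P \<in> carrier_mat m n" using QZ P by auto
  have "A * (Q * Z * P) = W * Z * P"
    using assoc_mult_mat[OF A QZ P] assoc_mult_mat[OF A Q Z] AQ by simp
  moreover have "W * Z * P * A = W * Z * W"
    using assoc_mult_mat[of "W * Z" n n P n A m] W Z P A PA by simp
  ultimately have "A * (Q * Z * P) * A = W" using WZ by simp
  moreover have "A * ?Y = A * X + A * (Q * Z * P)"
    by (rule mult_add_distrib_mat[OF A X QZP])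
  moreover have "(A * X + A * (Q * Z * P)) * A = A * X * A + A * (Q * Z * P) * A"
    using A X QZP by (intro add_mult_distrib_mat) auto
  moreover have "A * X * A + W = A"
    using A X by (auto simp: W_def)
  ultimately have "A * ?Y * A = A" by simp
  moreover have "?Y \<in> carrier_mat (dim_col A) (dim_row A)"
    using X QZP A by auto
  ultimately show ?thesis unfolding regular_mat_def by blast
qed

lemma zero_regular_mat: "regular_mat (0\<^sub>m n m :: 'a::ring_1 mat)"
  unfolding regular_mat_def
  by (rule bexI[of _ "0\<^sub>m m n"]) auto

text \<open>Induction on the number \<open>i\<close> of leading rows in which column
  \<open>j\<close> may be nonzero. Subtracting \<open>A * X * A\<close> kills the last such entry,
  leaves zero entries below it at zero, and leaves the other columns zero, so the defect falls under
  the induction hypothesis and \<open>regular_matI_defect\<close> returns to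
  \<open>A\<close>.\<close>

lemma regular_mat_single_col:
  fixes A :: "'a::ring_1 mat"
  assumes R: "von_neumann_regular TYPE('a)" and j: "j < m"
  shows "A \<in> carrier_mat n m \<Longrightarrow> i \<le> n \<Longrightarrow>
    (\<And>r c. r < n \<Longrightarrow> c < m \<Longrightarrow> r \<ge> i \<or> c \<noteq> j \<Longrightarrow> A $$ (r, c) = 0) \<Longrightarrow> regular_mat A"
proof (induction i arbitrary: A)
  case 0
  then have "A = 0\<^sub>m n m" by (intro eq_matI) auto
  then show ?case by (simp add: zero_regular_mat)
next
  case (Suc i)
  obtain b where b: "A $$ (i, j) * b * A $$ (i, j) = A $$ (i, j)"
    using R unfolding von_neumann_regular_def by blast
  \<comment> \<open>The quasi-inverse \<open>b\<close> of the entry at \<open>(i, j)\<close> is put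
    at the transposed position, so that \<open>A * X * A\<close> has entries
    \<open>A $$ (r, j) * b * A $$ (i, c)\<close>, which at \<open>(i, j)\<close> is the entry
    itself.\<close>
  define X where "X = mat m n (\<lambda>(r, c). if r = j \<and> c = i then b else 0)"
  have X: "X \<in> carrier_mat m n" by (simp add: X_def)
  have AX: "(A * X) $$ (r, c) = (if c = i then A $$ (r, j) * b else 0)" if "r < n" "c < n" for r c
  proof -
    have "(A * X) $$ (r, c) = (\<Sum>k\<in>{0..<m}. A $$ (r, k) * (if k = j \<and> c = i then b else 0))"
      using that Suc.prems(1) by (auto simp: X_def scalar_prod_def)
    also have "\<dots> = (\<Sum>k\<in>{0..<m}. if k = j then (if c = i then A $$ (r, k) * b else 0) else 0)"
      by (rule sum.cong) auto
    also have "\<dots> = (if c = i then A $$ (r, j) * b else 0)"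
      using j by simp
    finally show ?thesis .
  qed
  have AXA: "(A * X * A) $$ (r, c) = A $$ (r, j) * b * A $$ (i, c)" if "r < n" "c < m" for r c
  proof -
    have "(A * X * A) $$ (r, c) = (\<Sum>k\<in>{0..<n}. (A * X) $$ (r, k) * A $$ (k, c))"
      using that Suc.prems(1) X by (intro index_mult_mat_sum) auto
    also have "\<dots> = (\<Sum>k\<in>{0..<n}. if k = i then A $$ (r, j) * b * A $$ (k, c) else 0)"
      using that AX by (intro sum.cong) auto
    also have "\<dots> = A $$ (r, j) * b * A $$ (i, c)"
      using Suc.prems(2) by simp
    finally show ?thesis .
  qed
  have dAXA: "A * X * A \<in> carrier_mat n m" using Suc.prems(1) X by auto
  show ?case
  proof (rule regular_matI_defect[OF Suc.prems(1) X], rule Suc.IH)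
    show "A - A * X * A \<in> carrier_mat n m" by (rule minus_carrier_mat[OF dAXA])
    show "i \<le> n" using Suc.prems by simp
    fix r c assume rc: "r < n" "c < m" "i \<le> r \<or> c \<noteq> j"
    have *: "(A - A * X * A) $$ (r, c) = A $$ (r, c) - A $$ (r, j) * b * A $$ (i, c)"
      using rc dAXA AXA Suc.prems(1) by auto
    consider "c \<noteq> j" | "c = j" "r = i" | "c = j" "r > i" using rc(3) by linarith
    then show "(A - A * X * A) $$ (r, c) = 0"
      by cases (use * b Suc.prems rc j in auto)
  qed
qed

text \<open>Induction on the number \<open>k\<close> of leading columns that may be nonzero. The
  last of them, isolated as a matrix, has a quasi-inverse by \<open>regular_mat_single_col\<close>;
  it yields an \<open>X\<close> whose defect vanishes in that column too, while the columns beyond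
  it stay zero because each column of \<open>A * X * A\<close> is \<open>A * X\<close> times a
  column of \<open>A\<close>.\<close>

lemma regular_mat_cols:
  fixes A :: "'a::ring_1 mat"
  assumes R: "von_neumann_regular TYPE('a)"
  shows "A \<in> carrier_mat n m \<Longrightarrow> k \<le> m \<Longrightarrow>
    (\<And>r c. r < n \<Longrightarrow> c < m \<Longrightarrow> c \<ge> k \<Longrightarrow> A $$ (r, c) = 0) \<Longrightarrow> regular_mat A"
proof (induction k arbitrary: A)
  case 0
  then have "A = 0\<^sub>m n m" by (intro eq_matI) auto
  then show ?case by (simp add: zero_regular_mat)
next
  case (Suc k)
  note A = Suc.prems(1)
  have k: "k < m" using Suc.prems by simp
  \<comment> \<open>Right multiplication by this matrix unit keeps column \<open>k\<close> and
    erases all others.\<close>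
  define E :: "'a mat" where "E = mat m m (\<lambda>(r, c). if r = k \<and> c = k then 1 else 0)"
  have E: "E \<in> carrier_mat m m" by (simp add: E_def)
  have BE: "(B * E) $$ (r, c) = (if c = k then B $$ (r, k) else 0)"
    if "B \<in> carrier_mat n m" "r < n" "c < m" for B r c
  proof -
    have "(B * E) $$ (r, c) = (\<Sum>s\<in>{0..<m}. B $$ (r, s) * (if s = k \<and> c = k then 1 else 0))"
      using that by (auto simp: E_def scalar_prod_def)
    also have "\<dots> = (\<Sum>s\<in>{0..<m}. if s = k then (if c = k then B $$ (r, s) else 0) else 0)"
      by (rule sum.cong) auto
    also have "\<dots> = (if c = k then B $$ (r, k) else 0)"
      using k by simp
    finally show ?thesis .
  qed
  define a where "a = A * E"
  have a: "a \<in> carrier_mat n m" using A E by (auto simp: a_def)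
  have "regular_mat a"
    by (rule regular_mat_single_col[OF R k a order_refl]) (use BE[OF A] in \<open>auto simp: a_def\<close>)
  then obtain Y where Y: "Y \<in> carrier_mat m n" and aYa: "a * Y * a = a"
    using a by (auto simp: regular_mat_def)
  \<comment> \<open>The factor \<open>E\<close> is essential: it gives \<open>A * X = a * Y\<close>,
    hence \<open>A * X * A * E = a * Y * a = A * E\<close>, whereas \<open>Y\<close> alone would
    give \<open>A * Y * a\<close>.\<close>
  define X where "X = E * Y"
  have X: "X \<in> carrier_mat m n" using E Y by (auto simp: X_def)
  have AX: "A * X = a * Y"
    using A E Y by (simp add: X_def a_def assoc_mult_mat[OF A E Y])
  have dAXA: "A * X * A \<in> carrier_mat n m" using A X by auto
  have "A * X * A * E = a * Y * a"
    using assoc_mult_mat[OF mult_carrier_mat[OF a Y] A E] by (simp only: AX flip: a_def)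
  then have eq: "A * X * A * E = A * E" using aYa a_def by simp
  show ?case
  proof (rule regular_matI_defect[OF A X], rule Suc.IH)
    show "A - A * X * A \<in> carrier_mat n m" by (rule minus_carrier_mat[OF dAXA])
    show "k \<le> m" using k by simp
    fix r c assume rc: "r < n" "c < m" "k \<le> c"
    show "(A - A * X * A) $$ (r, c) = 0"
    proof (cases "c = k")
      case True
      have "A $$ (r, k) = (A * X * A) $$ (r, k)"
        using BE[OF A rc(1) k] BE[OF dAXA rc(1) k] eq by simp
      then show ?thesis using True rc dAXA A by auto
    next
      case False
      then have ck: "Suc k \<le> c" using rc by simp
      have "(A * X * A) $$ (r, c) = (\<Sum>s\<in>{0..<n}. (A * X) $$ (r, s) * A $$ (s, c))"
        using rc A X by (intro index_mult_mat_sum) auto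
      also have "\<dots> = 0"
        using Suc.prems(3) rc ck by (intro sum.neutral) auto
      finally show ?thesis using Suc.prems(3)[OF rc(1,2) ck] rc dAXA A by auto
    qed
  qed
qed

text \<open>The case \<open>k = m\<close> of the column induction, where the vanishing condition is
  vacuous.\<close>

lemma von_neumann_regular_mat:
  fixes A :: "'a::ring_1 mat"
  assumes "von_neumann_regular TYPE('a)" "A \<in> carrier_mat n m"
  obtains X where "X \<in> carrier_mat m n" "A * X * A = A"
  using regular_mat_cols[OF assms order_refl] assms(2) unfolding regular_mat_def by auto

section \<open>The matrix preorder\<close>

text \<open>The product clause of \<open>mat_lesssim\<close> freed from positivity of the
  dimensions, so that it also compares the empty matrices that presentations of modules may
  produce.\<close>

definition mat_le :: "'a::ring_1 mat \<Rightarrow> 'a mat \<Rightarrow> bool" where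
  "mat_le A B \<longleftrightarrow> (\<exists>C\<in>carrier_mat (dim_row A) (dim_row B).
    \<exists>D\<in>carrier_mat (dim_col B) (dim_col A). A = C * B * D)"

lemma mat_leI:
  assumes "A \<in> carrier_mat n m" "B \<in> carrier_mat k l" "C \<in> carrier_mat n k" "D \<in> carrier_mat l m"
    "A = C * B * D"
  shows "mat_le A B"
proof -
  have "C \<in> carrier_mat (dim_row A) (dim_row B)" "D \<in> carrier_mat (dim_col B) (dim_col A)"
    using assms(1-4) by auto
  with assms(5) show ?thesis unfolding mat_le_def by blast
qed

lemma mat_le_refl: "mat_le A A"
  by (rule mat_leI[of _ "dim_row A" "dim_col A" _ _ _ "1\<^sub>m (dim_row A)" "1\<^sub>m (dim_col A)"]) auto

lemma mat_le_trans:
  assumes "mat_le A B" "mat_le B L"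
  shows "mat_le A L"
proof -
  obtain C D where CD: "C \<in> carrier_mat (dim_row A) (dim_row B)"
    "D \<in> carrier_mat (dim_col B) (dim_col A)" and A: "A = C * B * D"
    using assms(1) unfolding mat_le_def by blast
  obtain C' D' where CD': "C' \<in> carrier_mat (dim_row B) (dim_row L)"
    "D' \<in> carrier_mat (dim_col L) (dim_col B)" and B: "B = C' * L * D'"
    using assms(2) unfolding mat_le_def by blast
  have L: "L \<in> carrier_mat (dim_row L) (dim_col L)" by auto
  have C'L: "C' * L \<in> carrier_mat (dim_row B) (dim_col L)" using CD' by auto
  have "A = C * (C' * L * D') * D" using A B by simp
  also have "C * (C' * L * D') = C * C' * L * D'"
    using assoc_mult_mat[OF CD(1) C'L CD'(2)] assoc_mult_mat[OF CD(1) CD'(1) L] by simp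
  also have "C * C' * L * D' * D = C * C' * L * (D' * D)"
    by (rule assoc_mult_mat[of _ "dim_row A" "dim_col L" _ "dim_col B" _ "dim_col A"])
       (use CD CD' in auto)
  finally have eq: "A = C * C' * L * (D' * D)" .
  show ?thesis
    by (rule mat_leI[OF _ L _ _ eq, of "dim_row A" "dim_col A"])
       (use CD CD' in auto)
qed

section \<open>Block diagonal matrices up to factorization\<close>

lemma block_diag_carrier:
  assumes "A \<in> carrier_mat n m" "B \<in> carrier_mat k l"
  shows "block_diag A B \<in> carrier_mat (n + k) (m + l)"
  using assms by (auto simp: block_diag_def)

lemma block_diag_dim [simp]:
  "dim_row (block_diag A B) = dim_row A + dim_row B"
  "dim_col (block_diag A B) = dim_col A + dim_col B"
  by (simp_all add: block_diag_def)

lemma block_diag_mult: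
  fixes A B C D :: "'a::ring_1 mat"
  assumes "A \<in> carrier_mat n1 m1" "B \<in> carrier_mat n2 m2"
    "C \<in> carrier_mat m1 l1" "D \<in> carrier_mat m2 l2"
  shows "block_diag A B * block_diag C D = block_diag (A * C) (B * D)"
proof -
  have "0\<^sub>m n1 m2 \<in> carrier_mat n1 m2" "0\<^sub>m n2 m1 \<in> carrier_mat n2 m1"
    "0\<^sub>m m1 l2 \<in> carrier_mat m1 l2" "0\<^sub>m m2 l1 \<in> carrier_mat m2 l1" by auto
  note mult_four_block_mat[OF assms(1) this(1,2) assms(2,3) this(3,4) assms(4)]
  then show ?thesis
    using assms by (auto simp: block_diag_def)
qed

lemma block_diag_mono:
  assumes "mat_le A B" "mat_le A' B'"
  shows "mat_le (block_diag A A') (block_diag B B')"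
proof -
  obtain C D where CD: "C \<in> carrier_mat (dim_row A) (dim_row B)"
    "D \<in> carrier_mat (dim_col B) (dim_col A)" and A: "A = C * B * D"
    using assms(1) unfolding mat_le_def by blast
  obtain C' D' where CD': "C' \<in> carrier_mat (dim_row A') (dim_row B')"
    "D' \<in> carrier_mat (dim_col B') (dim_col A')" and A': "A' = C' * B' * D'"
    using assms(2) unfolding mat_le_def by blast
  have B: "B \<in> carrier_mat (dim_row B) (dim_col B)" "B' \<in> carrier_mat (dim_row B') (dim_col B')"
    by auto
  have CB: "C * B \<in> carrier_mat (dim_row A) (dim_col B)"
    "C' * B' \<in> carrier_mat (dim_row A') (dim_col B')"
    using CD CD' by auto
  have "block_diag C C' * block_diag B B' * block_diag D D' = block_diag A A'"
    unfolding block_diag_mult[OF CD(1) CD'(1) B] block_diag_mult[OF CB CD(2) CD'(2)] A[symmetric]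
      A'[symmetric] ..
  note eq = this[symmetric]
  show ?thesis
    using CD CD' by (intro mat_leI[OF _ _ _ _ eq] block_diag_carrier) auto
qed

lemma block_diag_assoc:
  "block_diag (block_diag A B) C = block_diag A (block_diag B C)"
  unfolding block_diag_def by (rule assoc_four_block_mat[symmetric])

lemma block_diag_one: "block_diag (1\<^sub>m n) (1\<^sub>m m) = (1\<^sub>m (n + m) :: 'a::ring_1 mat)"
  by (auto simp: block_diag_def)

lemma block_diag_commute_le:
  fixes A B :: "'a::ring_1 mat"
  shows "mat_le (block_diag A B) (block_diag B A)"
proof -
  have A: "A \<in> carrier_mat (dim_row A) (dim_col A)" and B: "B \<in> carrier_mat (dim_row B) (dim_col B)"
    by auto
  \<comment> \<open>Block permutation matrices: \<open>?P\<close> swaps the two row blocks and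
    \<open>?Q\<close> the two column blocks.\<close>
  let ?P = "four_block_mat (0\<^sub>m (dim_row A) (dim_row B)) (1\<^sub>m (dim_row A))
    (1\<^sub>m (dim_row B)) (0\<^sub>m (dim_row B) (dim_row A)) :: 'a mat"
  let ?Q = "four_block_mat (0\<^sub>m (dim_col B) (dim_col A)) (1\<^sub>m (dim_col B))
    (1\<^sub>m (dim_col A)) (0\<^sub>m (dim_col A) (dim_col B)) :: 'a mat"
  have "?P * block_diag B A =
      four_block_mat (0\<^sub>m (dim_row A) (dim_col B)) A B (0\<^sub>m (dim_row B) (dim_col A))"
    unfolding block_diag_def
    by (subst mult_four_block_mat[of _ "dim_row A" "dim_row B" _ "dim_row A" _ "dim_row B" _ _ "dim_col B" _ "dim_col A"])
       auto
  also have "\<dots> * ?Q = block_diag A B"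
    unfolding block_diag_def
    by (subst mult_four_block_mat[of _ "dim_row A" "dim_col B" _ "dim_col A" _ "dim_row B" _ _ "dim_col A" _ "dim_col B"])
       auto
  finally have "block_diag A B = ?P * block_diag B A * ?Q" by simp
  moreover have "?P \<in> carrier_mat (dim_row A + dim_row B) (dim_row B + dim_row A)"
    "?Q \<in> carrier_mat (dim_col B + dim_col A) (dim_col A + dim_col B)" by auto
  ultimately show ?thesis
    by (intro mat_leI[OF block_diag_carrier[OF A B] block_diag_carrier[OF B A]])
qed

lemma block_diag_zero_le:
  fixes A :: "'a::ring_1 mat"
  shows "mat_le (block_diag A (0\<^sub>m n m)) A" and "mat_le A (block_diag A (0\<^sub>m n m))"
proof -
  have A: "A \<in> carrier_mat (dim_row A) (dim_col A)" by auto
  note bd = block_diag_carrier[OF A zero_carrier_mat[of n m]]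
  \<comment> \<open>Truncated identity matrices: \<open>?P\<close> and \<open>?Q\<close> append zero
    rows and columns, \<open>?P'\<close> and \<open>?Q'\<close> cut them off again.\<close>
  let ?P = "mat (dim_row A + n) (dim_row A) (\<lambda>(i, j). if i = j then 1 else 0) :: 'a mat"
  let ?Q = "mat (dim_col A) (dim_col A + m) (\<lambda>(i, j). if i = j then 1 else 0) :: 'a mat"
  let ?P' = "mat (dim_row A) (dim_row A + n) (\<lambda>(i, j). if i = j then 1 else 0) :: 'a mat"
  let ?Q' = "mat (dim_col A + m) (dim_col A) (\<lambda>(i, j). if i = j then 1 else 0) :: 'a mat"
  have if_mult: "(if b then 1 else 0) * x = (if b then x else 0)"
    "x * (if b then 1 else 0) = (if b then x else 0)" for b and x :: 'a
    by auto
  have "?P * A * ?Q = block_diag A (0\<^sub>m n m)"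
    by (rule eq_matI) (auto simp: block_diag_def scalar_prod_def if_mult)
  then show "mat_le (block_diag A (0\<^sub>m n m)) A"
    by (intro mat_leI[OF bd A, of ?P ?Q]) auto
  have "?P' * block_diag A (0\<^sub>m n m) * ?Q' = A"
    by (rule eq_matI) (auto simp: block_diag_def scalar_prod_def if_mult)
  then show "mat_le A (block_diag A (0\<^sub>m n m))"
    by (intro mat_leI[OF A bd, of ?P' ?Q']) auto
qed

text \<open>With \<open>C X C = C\<close>, multiplication by \<open>C X\<close> turns the off-diagonal block \<open>E\<close> into \<open>C X E\<close>, which is
  cleared by a column operation.\<close>

lemma block_diag_le_triangular:
  fixes C D E :: "'a::ring_1 mat"
  assumes R: "von_neumann_regular TYPE('a)"
    and C: "C \<in> carrier_mat n m" and D: "D \<in> carrier_mat k l" and E: "E \<in> carrier_mat n l"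
  shows "mat_le (block_diag C D) (four_block_mat C E (0\<^sub>m k m) D)"
proof -
  obtain X where X: "X \<in> carrier_mat m n" and CXC: "C * X * C = C"
    using von_neumann_regular_mat[OF R C] by blast
  let ?B = "four_block_mat C E (0\<^sub>m k m) D"
  let ?P = "four_block_mat (C * X) (0\<^sub>m n k) (0\<^sub>m k n) (1\<^sub>m k)"
  let ?Q = "four_block_mat (1\<^sub>m m) (- (X * E)) (0\<^sub>m l m) (1\<^sub>m l)"
  have CX: "C * X \<in> carrier_mat n n" and XE: "X * E \<in> carrier_mat m l"
    using C X E by auto
  have CXE: "C * X * E \<in> carrier_mat n l" using CX E by auto
  have "?P * ?B = four_block_mat C (C * X * E) (0\<^sub>m k m) D"
    using mult_four_block_mat[OF CX zero_carrier_mat zero_carrier_mat one_carrier_mat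
        C E zero_carrier_mat D] C D E CX CXE CXC
    by simp
  also have "\<dots> * ?Q = four_block_mat C (C * - (X * E) + C * X * E) (0\<^sub>m k m) D"
    using mult_four_block_mat[OF C CXE zero_carrier_mat D one_carrier_mat
        uminus_carrier_mat[OF XE] zero_carrier_mat one_carrier_mat] C D E CXE
      left_mult_zero_mat[OF uminus_carrier_mat[OF XE], of k]
    by simp
  also have "C * - (X * E) + C * X * E = - (C * X * E) + C * X * E"
    using C X by (simp add: assoc_mult_mat[OF C X E])
  also have "\<dots> = 0\<^sub>m n l" using CXE by (rule uminus_l_inv_mat)
  also have "four_block_mat C (0\<^sub>m n l) (0\<^sub>m k m) D = block_diag C D"
    using C D by (simp add: block_diag_def)
  finally have eq: "block_diag C D = ?P * ?B * ?Q" ..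
  show ?thesis
    by (rule mat_leI[OF block_diag_carrier[OF C D] four_block_carrier_mat[OF C D]
          four_block_carrier_mat[OF CX one_carrier_mat]
          four_block_carrier_mat[OF one_carrier_mat one_carrier_mat] eq])
qed

section \<open>Chains of matrices collapse to one factorization\<close>

lemma mat_le_imp_lesssim:
  assumes "mat_le A B" "A \<in> rect_mats" "B \<in> rect_mats"
  shows "mat_lesssim A B"
proof -
  obtain C D where CD: "C \<in> carrier_mat (dim_row A) (dim_row B)"
    "D \<in> carrier_mat (dim_col B) (dim_col A)" and A: "A = C * B * D"
    using assms(1) unfolding mat_le_def by blast
  have C: "C \<in> rect_mats" and D: "D \<in> rect_mats"
    and dims: "dim_col C = dim_row B" "dim_row D = dim_col B"
    using assms(2,3) CD by (auto simp: rect_mats_def)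
  show ?thesis
    unfolding mat_lesssim_def
    by (intro conjI disjI1 bexI[OF _ C] bexI[OF _ D] assms(2,3) dims A)
qed

lemma mat_lesssim_imp_le:
  fixes A B :: "'a::ring_1 mat"
  assumes R: "von_neumann_regular TYPE('a)" and "mat_lesssim A B"
  shows "mat_le A B"
proof -
  have product: "mat_le (C * B * D) B" if "dim_col C = dim_row B" "dim_row D = dim_col B" for C D
    by (rule mat_leI[OF _ _ carrier_matI[OF refl that(1)] carrier_matI[OF that(2) refl] refl]) auto
  have triangular: "mat_le (block_diag C D) (four_block_mat C E (0\<^sub>m (dim_row D) (dim_col C)) D)"
    if "E \<in> carrier_mat (dim_row C) (dim_col D)" for C D E :: "'a mat"
    by (rule block_diag_le_triangular[OF R _ _ that]) auto
  show ?thesis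
    using assms(2) unfolding mat_lesssim_def
    by (elim conjE disjE bexE) (simp_all only: product triangular)
qed

text \<open>Each link of a chain is a factorization, the triangular links by
  \<open>block_diag_le_triangular\<close>, and factorizations compose by
  \<open>mat_le_trans\<close>.\<close>

lemma mat_preceq_iff:
  fixes A B :: "'a::ring_1 mat"
  assumes R: "von_neumann_regular TYPE('a)" and "A \<in> rect_mats" "B \<in> rect_mats"
  shows "mat_preceq A B \<longleftrightarrow> mat_le A B"
proof
  assume "mat_preceq A B"
  then have "mat_lesssim\<^sup>*\<^sup>* A B" unfolding mat_preceq_def .
  then show "mat_le A B"
  proof (induction rule: rtranclp_induct)
    case base
    show ?case by (rule mat_le_refl)
  next
    case (step B L)
    from step.IH mat_lesssim_imp_le[OF R step.hyps(2)] show ?case by (rule mat_le_trans)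
  qed
next
  assume "mat_le A B"
  then show "mat_preceq A B"
    unfolding mat_preceq_def by (intro r_into_rtranclp mat_le_imp_lesssim assms)
qed

section \<open>Retracts of left modules\<close>

lemma left_hom_comp:
  assumes "f \<in> left_hom L M" "g \<in> left_hom M N"
  shows "(\<lambda>x. g (f x)) \<in> left_hom L N"
  using assms by (auto simp: left_hom_def Pi_iff)

lemma left_hom_id: "(\<lambda>x. x) \<in> left_hom M M"
  by (simp add: left_hom_def)

lemma left_hom_add:
  assumes "left_module M" "left_module N" "f \<in> left_hom M N" "g \<in> left_hom M N"
  shows "(\<lambda>x. f x \<oplus>\<^bsub>N\<^esub> g x) \<in> left_hom M N"
proof -
  interpret M: left_module M by fact
  interpret N: left_module N by fact
  note f = left_homD[OF assms(3)] and g = left_homD[OF assms(4)]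
  show ?thesis
    by (auto simp: left_hom_def f g N.a_ac N.smult_r_distr)
qed

lemma (in left_module) smult_zero_left: "x \<in> carrier M \<Longrightarrow> 0 \<odot> x = \<zero>"
  using smult_l_distr[of x 0 0] smult_closed[of x 0] add.r_cancel_one[of "0 \<odot> x" "0 \<odot> x"] by simp

lemma (in left_module) smult_minus_one: "x \<in> carrier M \<Longrightarrow> (- 1) \<odot> x = \<ominus> x"
  using smult_l_distr[of x "- 1" 1] smult_closed[of x "- 1"] smult_zero_left[of x] smult_one[of x]
  by (intro minus_equality[symmetric]) simp_all

lemma (in left_module) smult_minus_right: "x \<in> carrier M \<Longrightarrow> a \<odot> (\<ominus> x) = \<ominus> (a \<odot> x)"
  using smult_assoc[of x a "- 1"] smult_assoc[of x "- 1" a]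
  by (simp add: smult_minus_one[symmetric] smult_closed)

lemma left_hom_diff:
  assumes "left_module M" "left_module N" "f \<in> left_hom M N" "g \<in> left_hom M N"
  shows "(\<lambda>x. f x \<ominus>\<^bsub>N\<^esub> g x) \<in> left_hom M N"
proof -
  interpret N: left_module N by fact
  note g = left_homD[OF assms(4)]
  have "(\<lambda>x. \<ominus>\<^bsub>N\<^esub> g x) \<in> left_hom M N"
    by (auto simp: left_hom_def g N.minus_add N.smult_minus_right)
  from left_hom_add[OF assms(1-3) this] show ?thesis
    by (simp add: a_minus_def)
qed

lemma left_isomorphic_trans:
  assumes "left_isomorphic L M" "left_isomorphic M N"
  shows "left_isomorphic L N"
proof -
  obtain h k where "h \<in> left_hom L M" "bij_betw h (carrier L) (carrier M)"
    "k \<in> left_hom M N" "bij_betw k (carrier M) (carrier N)"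
    using assms unfolding left_isomorphic_def by blast
  then show ?thesis
    using left_hom_comp[of h L M k N] bij_betw_trans[of h "carrier L" "carrier M" k "carrier N"]
    unfolding left_isomorphic_def comp_def by blast
qed

text \<open>This says that \<open>M\<close> is isomorphic to a direct summand of \<open>N\<close>,
  without naming a complement; the two modules may live on different types.\<close>

definition module_retract ::
    "('a, 'b, 'm) module_scheme \<Rightarrow> ('a, 'c, 'n) module_scheme \<Rightarrow> bool" where
  "module_retract M N \<longleftrightarrow>
    (\<exists>f\<in>left_hom M N. \<exists>g\<in>left_hom N M. \<forall>x\<in>carrier M. g (f x) = x)"

lemma module_retractI:
  assumes "f \<in> left_hom M N" "g \<in> left_hom N M" "\<And>x. x \<in> carrier M \<Longrightarrow> g (f x) = x"
  shows "module_retract M N"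
  using assms unfolding module_retract_def by blast

lemma module_retractE:
  assumes "module_retract M N"
  obtains f g where "f \<in> left_hom M N" "g \<in> left_hom N M" "\<forall>x\<in>carrier M. g (f x) = x"
  using assms unfolding module_retract_def by blast

lemma module_retract_refl: "module_retract M M"
  by (rule module_retractI[OF left_hom_id left_hom_id]) simp

lemma module_retract_trans:
  assumes "module_retract L M" "module_retract M N"
  shows "module_retract L N"
proof -
  obtain f g where fg: "f \<in> left_hom L M" "g \<in> left_hom M L"
    "\<forall>x\<in>carrier L. g (f x) = x"
    using assms(1) by (rule module_retractE)
  obtain f' g' where fg': "f' \<in> left_hom M N" "g' \<in> left_hom N M"
    "\<forall>x\<in>carrier M. g' (f' x) = x"
    using assms(2) by (rule module_retractE)
  show ?thesis
    by (rule module_retractI[OF left_hom_comp[OF fg(1) fg'(1)] left_hom_comp[OF fg'(2) fg(2)]])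
       (simp add: fg(3) fg'(3) left_homD(1)[OF fg(1)])
qed

lemma left_isomorphic_imp_retract:
  assumes "left_module M" "left_isomorphic M N"
  shows "module_retract M N" and "module_retract N M"
proof -
  interpret M: left_module M by fact
  obtain h where h: "h \<in> left_hom M N" and b: "bij_betw h (carrier M) (carrier N)"
    using assms(2) by (auto simp: left_isomorphic_def)
  let ?k = "inv_into (carrier M) h"
  have kh: "?k (h x) = x" if "x \<in> carrier M" for x
    using b that by (simp add: bij_betw_inv_into_left)
  have hk: "h (?k y) = y" if "y \<in> carrier N" for y
    using b that by (simp add: bij_betw_inv_into_right)
  have c: "carrier N = h ` carrier M" using b by (simp add: bij_betw_def)
  have k: "?k \<in> left_hom N M"
    unfolding left_hom_def c
    using kh M.smult_closed by (auto simp: left_homD(2,3)[OF h, symmetric])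
  show "module_retract M N" by (rule module_retractI[OF h k kh])
  show "module_retract N M" by (rule module_retractI[OF k h hk])
qed

section \<open>Submodules and maps into and out of them\<close>

lemma left_submodule_subset: "left_submodule M S \<Longrightarrow> S \<subseteq> carrier M"
  unfolding left_submodule_def using subgroup.subset by fastforce

lemma left_submoduleD:
  assumes "left_submodule M S"
  shows "\<zero>\<^bsub>M\<^esub> \<in> S" "x \<in> S \<Longrightarrow> y \<in> S \<Longrightarrow> x \<oplus>\<^bsub>M\<^esub> y \<in> S" "x \<in> S \<Longrightarrow> a \<odot>\<^bsub>M\<^esub> x \<in> S"
    "x \<in> S \<Longrightarrow> \<ominus>\<^bsub>M\<^esub> x \<in> S"
  using assms subgroup.one_closed subgroup.m_closed subgroup.m_inv_closed
  unfolding left_submodule_def a_inv_def by fastforce+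

lemma left_submoduleI:
  assumes "left_module M" "S \<subseteq> carrier M" "\<zero>\<^bsub>M\<^esub> \<in> S"
    "\<And>x y. x \<in> S \<Longrightarrow> y \<in> S \<Longrightarrow> x \<oplus>\<^bsub>M\<^esub> y \<in> S" "\<And>a x. x \<in> S \<Longrightarrow> a \<odot>\<^bsub>M\<^esub> x \<in> S"
  shows "left_submodule M S"
proof -
  interpret M: left_module M by fact
  have "\<ominus>\<^bsub>M\<^esub> x \<in> S" if "x \<in> S" for x
    using assms(5)[OF that, of "- 1"] M.smult_minus_one[of x] assms(2) that by auto
  then have "subgroup S (add_monoid M)"
    using assms(2-4) by (intro M.add.subgroupI) (auto simp: a_inv_def)
  then show ?thesis using assms(5) by (simp add: left_submodule_def)
qed

lemma left_submodule_left_module: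
  assumes "left_module M" "left_submodule M S"
  shows "left_module (M\<lparr>carrier := S\<rparr>)"
proof -
  interpret M: left_module M by fact
  note S = left_submodule_subset[OF assms(2), THEN subsetD]
  note closed = left_submoduleD[OF assms(2)]
  have "abelian_group (M\<lparr>carrier := S\<rparr>)"
  proof (rule abelian_groupI)
    fix x assume "x \<in> carrier (M\<lparr>carrier := S\<rparr>)"
    then show "\<exists>y\<in>carrier (M\<lparr>carrier := S\<rparr>). y \<oplus>\<^bsub>M\<lparr>carrier := S\<rparr>\<^esub> x = \<zero>\<^bsub>M\<lparr>carrier := S\<rparr>\<^esub>"
      using closed(4) S M.l_neg by auto
  qed (use closed S in \<open>auto simp: M.a_ac\<close>)
  then show ?thesis
    by (rule left_module.intro, intro left_module_axioms.intro)
       (use closed S in \<open>auto simp: M.smult_l_distr M.smult_r_distr M.smult_assoc M.smult_one\<close>)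
qed

lemma left_hom_restrict:
  "f \<in> left_hom M N \<Longrightarrow> S \<subseteq> carrier M \<Longrightarrow> f \<in> left_hom (M\<lparr>carrier := S\<rparr>) N"
  unfolding left_hom_def by (auto simp: Pi_iff subset_iff)

lemma left_hom_extend:
  "f \<in> left_hom M (N\<lparr>carrier := S\<rparr>) \<Longrightarrow> S \<subseteq> carrier N \<Longrightarrow> f \<in> left_hom M N"
  unfolding left_hom_def by (auto simp: Pi_iff)

lemma left_module_module_vec: "left_module (module_vec TYPE('a::ring_1) n)"
proof -
  have "abelian_group (module_vec TYPE('a) n)"
  proof (rule abelian_groupI)
    fix x :: "'a vec" assume x: "x \<in> carrier (module_vec TYPE('a) n)"
    show "\<exists>y\<in>carrier (module_vec TYPE('a) n).
        y \<oplus>\<^bsub>module_vec TYPE('a) n\<^esub> x = \<zero>\<^bsub>module_vec TYPE('a) n\<^esub>"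
      using x by (intro bexI[of _ "- x"]) (auto simp: module_vec_simps)
  qed (auto simp: module_vec_simps assoc_add_vec intro: comm_add_vec)
  then show ?thesis
    by (rule left_module.intro, intro left_module_axioms.intro)
       (auto simp: module_vec_simps add_smult_distrib_vec smult_add_distrib_vec smult_smult_assoc)
qed

section \<open>Row vectors times matrices\<close>

lemma row_vec_mult_dim [simp]: "dim_vec (row_vec_mult x A) = dim_col A"
  by (simp add: row_vec_mult_def)

lemma row_vec_mult_carrier [intro]: "A \<in> carrier_mat n m \<Longrightarrow> row_vec_mult x A \<in> carrier_vec m"
  by (auto simp: row_vec_mult_def)

lemma index_row_vec_mult [simp]: "j < dim_col A \<Longrightarrow> row_vec_mult x A $ j = x \<bullet> col A j"
  by (simp add: row_vec_mult_def)

lemma row_vec_mult_add: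
  assumes "x \<in> carrier_vec n" "y \<in> carrier_vec n" "A \<in> carrier_mat n m"
  shows "row_vec_mult (x + y) A = row_vec_mult x A + row_vec_mult y A"
  using assms by (intro eq_vecI) (auto intro!: add_scalar_prod_distrib)

lemma row_vec_mult_smult:
  assumes "x \<in> carrier_vec n" "A \<in> carrier_mat n m"
  shows "row_vec_mult (a \<cdot>\<^sub>v x) A = a \<cdot>\<^sub>v row_vec_mult x A"
  using assms by (intro eq_vecI) (auto intro!: smult_scalar_prod_distrib)

lemma row_mult_mat:
  "i < dim_row A \<Longrightarrow> row (A * B) i = row_vec_mult (row A i) B"
  by (intro eq_vecI) auto

lemma row_vec_mult_unit:
  fixes A :: "'a::ring_1 mat"
  assumes "A \<in> carrier_mat n m" "i < n"
  shows "row_vec_mult (unit_vec n i) A = row A i"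
  using assms row_mult_mat[of i "1\<^sub>m n" A] by simp

text \<open>The vector becomes a matrix with one row, so that associativity of the matrix product
  applies.\<close>

lemma row_vec_mult_assoc:
  assumes x: "x \<in> carrier_vec n" and A: "A \<in> carrier_mat n m" and B: "B \<in> carrier_mat m k"
  shows "row_vec_mult x (A * B) = row_vec_mult (row_vec_mult x A) B"
proof -
  define X where "X = mat 1 n (\<lambda>(_, j). x $ j)"
  have X: "X \<in> carrier_mat 1 n" by (simp add: X_def)
  have row: "row X 0 = x" using x by (auto simp: X_def)
  have "row (X * (A * B)) 0 = row (X * A * B) 0"
    using assoc_mult_mat[OF X A B] by simp
  then show ?thesis
    using X row by (simp add: row_mult_mat)
qed

lemma row_vec_mult_one: "x \<in> carrier_vec n \<Longrightarrow> row_vec_mult x (1\<^sub>m n :: 'a::ring_1 mat) = x"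
  by (intro eq_vecI) auto

lemma row_vec_mult_minus:
  fixes A :: "'a::ring_1 mat"
  assumes "x \<in> carrier_vec n" "A \<in> carrier_mat n m" "B \<in> carrier_mat n m"
  shows "row_vec_mult x (A - B) = row_vec_mult x A - row_vec_mult x B"
  using assms
  by (intro eq_vecI) (auto simp: scalar_prod_def algebra_simps sum_subtractf)

lemma eq_mat_row_vec_multI:
  fixes A B :: "'a::ring_1 mat"
  assumes A: "A \<in> carrier_mat n m" and B: "B \<in> carrier_mat n m"
    and eq: "\<And>x. x \<in> carrier_vec n \<Longrightarrow> row_vec_mult x A = row_vec_mult x B"
  shows "A = B"
proof (rule eq_rowI)
  fix i assume "i < dim_row B"
  then show "row A i = row B i"
    using eq[of "unit_vec n i"] row_vec_mult_unit[OF A, of i] row_vec_mult_unit[OF B, of i] B by simp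
qed (use A B in auto)

lemma row_vec_mult_hom:
  "A \<in> carrier_mat n m \<Longrightarrow>
    (\<lambda>x. row_vec_mult x A) \<in> left_hom (module_vec TYPE('a::ring_1) n) (module_vec TYPE('a) m)"
  by (auto simp: left_hom_def module_vec_simps row_vec_mult_add row_vec_mult_smult)

section \<open>Homomorphisms out of free modules\<close>

text \<open>Induction on the number \<open>k\<close> of leading coordinates that may be nonzero:
  removing the last one splits off a multiple of a unit vector, on which both maps agree. This
  avoids writing a vector as a finite sum in the free module.\<close>

lemma free_hom_ext:
  fixes N :: "('a::ring_1, 'b, 'm) module_scheme"
  assumes N: "left_module N" and f: "f \<in> left_hom (module_vec TYPE('a) n) N"
    and g: "g \<in> left_hom (module_vec TYPE('a) n) N"
    and eq: "\<And>i. i < n \<Longrightarrow> f (unit_vec n i) = g (unit_vec n i)"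
    and x: "x \<in> carrier_vec n"
  shows "f x = g x"
proof -
  have "\<forall>x\<in>carrier_vec n. (\<forall>i<n. k \<le> i \<longrightarrow> x $ i = 0) \<longrightarrow> f x = g x" if "k \<le> n" for k
    using that
  proof (induction k)
    case 0
    have "x = 0\<^sub>v n" if "x \<in> carrier_vec n" "\<forall>i<n. 0 \<le> i \<longrightarrow> x $ i = 0" for x :: "'a vec"
      using that by (intro eq_vecI) auto
    then show ?case
      using left_hom_zero[OF left_module_module_vec N f] left_hom_zero[OF left_module_module_vec N g]
      by (auto simp: module_vec_simps)
  next
    case (Suc k)
    show ?case
    proof (intro ballI impI)
      fix x :: "'a vec" assume x: "x \<in> carrier_vec n" "\<forall>i<n. Suc k \<le> i \<longrightarrow> x $ i = 0"
      define y where "y = vec n (\<lambda>i. if i = k then 0 else x $ i)"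
      let ?e = "unit_vec n k :: 'a vec"
      have y: "y \<in> carrier_vec n" by (simp add: y_def)
      have yk: "f y = g y"
        using Suc.IH Suc.prems y x by (auto simp: y_def)
      have xy: "x = y + x $ k \<cdot>\<^sub>v ?e"
        using x Suc.prems by (intro eq_vecI) (auto simp: y_def)
      have e: "?e \<in> carrier_vec n" "x $ k \<cdot>\<^sub>v ?e \<in> carrier_vec n" by auto
      have "h x = h y \<oplus>\<^bsub>N\<^esub> x $ k \<odot>\<^bsub>N\<^esub> h ?e" if "h \<in> left_hom (module_vec TYPE('a) n) N" for h
        using left_homD(2,3)[OF that] y e by (subst xy) (auto simp: module_vec_simps)
      from this[OF f] this[OF g] show "f x = g x" using yk eq[of k] Suc.prems by simp
    qed
  qed
  from this[OF order_refl] x show ?thesis by auto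
qed

lemma (in left_module) smult_finsum:
  assumes "finite A" "f \<in> A \<rightarrow> carrier M"
  shows "a \<odot> finsum M f A = finsum M (\<lambda>i. a \<odot> f i) A"
  using assms
proof (induction A)
  case (insert i A)
  then have "f i \<in> carrier M" "f \<in> A \<rightarrow> carrier M" "(\<lambda>i. a \<odot> f i) \<in> A \<rightarrow> carrier M"
    by (auto simp: smult_closed Pi_iff)
  with insert show ?case by (simp add: finsum_insert smult_r_distr smult_closed)
qed (simp add: smult_zero)

lemma free_hom_exists:
  fixes N :: "('a::ring_1, 'b, 'm) module_scheme"
  assumes N: "left_module N" and v: "\<And>i. i < n \<Longrightarrow> v i \<in> carrier N"
  obtains f where "f \<in> left_hom (module_vec TYPE('a) n) N" "\<And>i. i < n \<Longrightarrow> f (unit_vec n i) = v i"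
proof -
  interpret N: left_module N by fact
  define f where "f x = finsum N (\<lambda>i. x $ i \<odot>\<^bsub>N\<^esub> v i) {..<n}" for x
  have cl: "(\<lambda>i. x $ i \<odot>\<^bsub>N\<^esub> v i) \<in> {..<n} \<rightarrow> carrier N" for x
    using v by (auto simp: N.smult_closed)
  have "f (x + y) = f x \<oplus>\<^bsub>N\<^esub> f y" if "x \<in> carrier_vec n" "y \<in> carrier_vec n" for x y
  proof -
    have "f (x + y) = finsum N (\<lambda>i. x $ i \<odot>\<^bsub>N\<^esub> v i \<oplus>\<^bsub>N\<^esub> y $ i \<odot>\<^bsub>N\<^esub> v i) {..<n}"
      unfolding f_def using that v
      by (intro N.finsum_cong') (auto simp: N.smult_l_distr N.smult_closed)
    then show ?thesis unfolding f_def by (simp only: N.finsum_addf[OF cl cl])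
  qed
  moreover have "f (a \<cdot>\<^sub>v x) = a \<odot>\<^bsub>N\<^esub> f x" if "x \<in> carrier_vec n" for a x
    unfolding f_def using that v cl
    by (subst N.smult_finsum) (auto simp: N.smult_assoc N.smult_closed intro!: N.finsum_cong')
  ultimately have "f \<in> left_hom (module_vec TYPE('a) n) N"
    using cl by (auto simp: left_hom_def module_vec_simps f_def)
  moreover have "f (unit_vec n i) = v i" if i: "i < n" for i
  proof -
    have "f (unit_vec n i) = finsum N (\<lambda>j. if i = j then v j else \<zero>\<^bsub>N\<^esub>) {..<n}"
      unfolding f_def using i v
      by (intro N.finsum_cong') (auto simp: N.smult_one N.smult_zero_left)
    also have "\<dots> = v i"
      using i v by (intro N.add.finprod_singleton) auto
    finally show ?thesis .
  qed
  ultimately show thesis by (rule that)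
qed

text \<open>Projectivity of free modules: preimages are chosen for the images of the unit vectors,
  and agreement there suffices by \<open>free_hom_ext\<close>.\<close>

lemma free_hom_lift:
  fixes N :: "('a::ring_1, 'b, 'm) module_scheme" and M :: "('a, 'c, 'n) module_scheme"
  assumes M: "left_module M" and N: "left_module N"
    and g: "g \<in> left_hom M N" "g ` carrier M = carrier N"
    and h: "h \<in> left_hom (module_vec TYPE('a) n) N"
  obtains l where "l \<in> left_hom (module_vec TYPE('a) n) M"
    "\<And>x. x \<in> carrier_vec n \<Longrightarrow> g (l x) = h x"
proof -
  \<comment> \<open>No bound on \<open>i\<close> is required: beyond the dimension
    \<open>unit_vec n i\<close> is still a vector of length \<open>n\<close>, so the choice function
    can be total.\<close>
  have "\<exists>y\<in>carrier M. g y = h (unit_vec n i)" for i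
    using left_homD(1)[OF h, of "unit_vec n i"] g(2) by (force simp: module_vec_simps)
  then obtain v where v: "\<And>i. v i \<in> carrier M" "\<And>i. g (v i) = h (unit_vec n i)" by metis
  obtain l where l: "l \<in> left_hom (module_vec TYPE('a) n) M" "\<And>i. i < n \<Longrightarrow> l (unit_vec n i) = v i"
    using free_hom_exists[OF M, of n v] v(1) by blast
  have "g (l x) = h x" if "x \<in> carrier_vec n" for x
    by (rule free_hom_ext[OF N left_hom_comp[OF l(1) g(1)] h _ that]) (simp add: l v)
  with l(1) show thesis by (rule that)
qed

text \<open>The rows of \<open>F\<close> are the images of the unit vectors. As scalars act from the
  left, homomorphisms act by multiplication from the right.\<close>

lemma free_hom_matrix:
  assumes f: "f \<in> left_hom (module_vec TYPE('a::ring_1) n) (module_vec TYPE('a) m)"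
  obtains F where "F \<in> carrier_mat n m" "\<And>x. x \<in> carrier_vec n \<Longrightarrow> f x = row_vec_mult x F"
proof -
  define F where "F = mat n m (\<lambda>(i, j). f (unit_vec n i) $ j)"
  have F: "F \<in> carrier_mat n m" by (simp add: F_def)
  have "f x = row_vec_mult x F" if x: "x \<in> carrier_vec n" for x
  proof (rule free_hom_ext[OF left_module_module_vec f row_vec_mult_hom[OF F] _ x])
    fix i assume i: "i < n"
    have "f (unit_vec n i) \<in> carrier_vec m"
      using left_homD(1)[OF f] by (auto simp: module_vec_simps)
    then show "f (unit_vec n i) = row_vec_mult (unit_vec n i) F"
      unfolding row_vec_mult_unit[OF F i] using i by (intro eq_vecI) (auto simp: F_def)
  qed
  with F show thesis by (rule that)
qed

section \<open>Row spaces as submodules of free modules\<close>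

lemma row_module_simps:
  "carrier (row_module A) = {row_vec_mult x A |x. x \<in> carrier_vec (dim_row A)}"
  "add (row_module A) = (+)" "zero (row_module A) = 0\<^sub>v (dim_col A)" "smult (row_module A) = (\<cdot>\<^sub>v)"
  by (simp_all add: row_module_def module_vec_simps)

lemma row_module_memI:
  "x \<in> carrier_vec n \<Longrightarrow> A \<in> carrier_mat n m \<Longrightarrow> row_vec_mult x A \<in> carrier (row_module A)"
  by (auto simp: row_module_simps)

lemma row_module_memE:
  assumes "y \<in> carrier (row_module A)" "A \<in> carrier_mat n m"
  obtains x where "x \<in> carrier_vec n" "y = row_vec_mult x A"
  using assms by (auto simp: row_module_simps)

lemma row_module_submodule:
  fixes A :: "'a::ring_1 mat"
  assumes A: "A \<in> carrier_mat n m"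
  shows "left_submodule (module_vec TYPE('a) m) (carrier (row_module A))"
proof (rule left_submoduleI[OF left_module_module_vec])
  show "carrier (row_module A) \<subseteq> carrier (module_vec TYPE('a) m)"
    using A by (auto simp: row_module_simps module_vec_simps)
  have "row_vec_mult (0\<^sub>v n) A = 0\<^sub>v m"
    using A by (intro eq_vecI) auto
  then show "\<zero>\<^bsub>module_vec TYPE('a) m\<^esub> \<in> carrier (row_module A)"
    using row_module_memI[OF zero_carrier_vec A] by (simp add: module_vec_simps)
next
  fix y z assume "y \<in> carrier (row_module A)" "z \<in> carrier (row_module A)"
  then show "y \<oplus>\<^bsub>module_vec TYPE('a) m\<^esub> z \<in> carrier (row_module A)"
    using A row_module_memI[OF add_carrier_vec A]
    by (auto elim!: row_module_memE[OF _ A] simp: module_vec_simps row_vec_mult_add[symmetric])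
next
  fix a y assume "y \<in> carrier (row_module A)"
  then show "a \<odot>\<^bsub>module_vec TYPE('a) m\<^esub> y \<in> carrier (row_module A)"
    using A row_module_memI[OF smult_carrier_vec[THEN iffD2] A]
    by (auto elim!: row_module_memE[OF _ A] simp: module_vec_simps row_vec_mult_smult[symmetric])
qed

lemma row_module_eq:
  fixes A :: "'a::ring_1 mat"
  assumes "A \<in> carrier_mat n m"
  shows "row_module A = (module_vec TYPE('a) m)\<lparr>carrier := carrier (row_module A)\<rparr>"
  using assms by (simp add: row_module_def)

lemma left_module_row_module: "left_module (row_module (A :: 'a::ring_1 mat))"
  using left_submodule_left_module[OF left_module_module_vec row_module_submodule[of A]]
  by (subst row_module_eq[of A]) auto

lemma row_module_hom:
  fixes A :: "'a::ring_1 mat"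
  assumes A: "A \<in> carrier_mat n m" and X: "X \<in> carrier_mat m k"
  shows "(\<lambda>y. row_vec_mult y X) \<in> left_hom (row_module A) (module_vec TYPE('a) k)"
  using row_vec_mult_hom[OF X] left_submodule_subset[OF row_module_submodule[OF A]]
  by (subst row_module_eq[OF A]) (rule left_hom_restrict)

lemma left_hom_into_row_module:
  fixes A :: "'a::ring_1 mat"
  assumes "A \<in> carrier_mat n m" "f \<in> left_hom M (module_vec TYPE('a) m)"
    "\<And>x. x \<in> carrier M \<Longrightarrow> f x \<in> carrier (row_module A)"
  shows "f \<in> left_hom M (row_module A)"
  using assms by (auto simp: left_hom_def module_vec_simps row_module_simps)

section \<open>Row modules and finitely presented modules\<close>

text \<open>For \<open>A = C * B * D\<close>, sending \<open>x A\<close> to \<open>x C B\<close>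
  need not be well defined. With \<open>A * X * A = A\<close>, the vector \<open>y X\<close> is a
  preimage of \<open>y = x A\<close> that depends linearly on \<open>y\<close>, which leads to
  \<open>y X C B\<close>. On the way back, \<open>z D\<close> need not lie in the row space of
  \<open>A\<close>, so the idempotent \<open>X * A\<close> is applied to it. The composite
  multiplies \<open>x A\<close> by \<open>X A X A\<close>, that is, it fixes
  \<open>x A\<close>.\<close>

lemma mat_le_imp_row_module_retract:
  fixes A B :: "'a::ring_1 mat"
  assumes R: "von_neumann_regular TYPE('a)" and "mat_le A B"
  shows "module_retract (row_module A) (row_module B)"
proof -
  obtain n m where A: "A \<in> carrier_mat n m" by auto
  obtain k l where B: "B \<in> carrier_mat k l" by auto
  obtain C D where C: "C \<in> carrier_mat n k" and D: "D \<in> carrier_mat l m" and eq: "A = C * B * D"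
    using assms(2) A B unfolding mat_le_def by auto
  obtain X where X: "X \<in> carrier_mat m n" and AXA: "A * X * A = A"
    using von_neumann_regular_mat[OF R A] .
  have XC: "X * C \<in> carrier_mat m k" using X C by auto
  have F: "X * C * B \<in> carrier_mat m l" using XC B by auto
  have DX: "D * X \<in> carrier_mat l n" using D X by auto
  have G: "D * X * A \<in> carrier_mat l m" using DX A by auto
  let ?f = "\<lambda>y. row_vec_mult y (X * C * B)" and ?g = "\<lambda>z. row_vec_mult z (D * X * A)"
  have f: "?f \<in> left_hom (row_module A) (row_module B)"
  proof (rule left_hom_into_row_module[OF B row_module_hom[OF A F]])
    fix y assume "y \<in> carrier (row_module A)"
    then have "y \<in> carrier_vec m" using A by (auto simp: row_module_simps)
    then show "?f y \<in> carrier (row_module B)"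
      using row_module_memI[OF row_vec_mult_carrier[OF XC] B] by (simp add: row_vec_mult_assoc[OF _ XC B])
  qed
  have g: "?g \<in> left_hom (row_module B) (row_module A)"
  proof (rule left_hom_into_row_module[OF A row_module_hom[OF B G]])
    fix z assume "z \<in> carrier (row_module B)"
    then have "z \<in> carrier_vec l" using B by (auto simp: row_module_simps)
    then show "?g z \<in> carrier (row_module A)"
      using row_module_memI[OF row_vec_mult_carrier[OF DX] A] by (simp add: row_vec_mult_assoc[OF _ DX A])
  qed
  have BD: "B * D \<in> carrier_mat k m" using B D by auto
  have XA: "X * A \<in> carrier_mat m m" using X A by auto
  have XCBD: "X * C * B * D = X * A"
    using eq assoc_mult_mat[OF XC B D] assoc_mult_mat[OF X C BD] assoc_mult_mat[OF C B D] by simp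
  have FG: "X * C * B * (D * X * A) = X * A * (X * A)"
    using XCBD assoc_mult_mat[OF F D XA] assoc_mult_mat[OF D X A] by simp
  have AFG: "A * (X * C * B * (D * X * A)) = A"
    unfolding FG using AXA assoc_mult_mat[OF A XA XA] assoc_mult_mat[OF A X A] by simp
  have "?g (?f y) = y" if y_in: "y \<in> carrier (row_module A)" for y
  proof -
    obtain x where x: "x \<in> carrier_vec n" and y: "y = row_vec_mult x A"
      using row_module_memE[OF y_in A] .
    have "?g (?f y) = row_vec_mult y (X * C * B * (D * X * A))"
      unfolding y using row_vec_mult_assoc[OF row_vec_mult_carrier[OF A] F G] by simp
    also have "\<dots> = row_vec_mult x (A * (X * C * B * (D * X * A)))"
      using row_vec_mult_assoc[OF x A mult_carrier_mat[OF F G]] y by simp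
    finally show ?thesis using AFG y by simp
  qed
  with f g show ?thesis by (rule module_retractI)
qed

text \<open>\<open>X * A\<close> is an idempotent projecting onto the row space of \<open>A\<close>;
  in this form the quasi-inverse picks a coefficient vector \<open>y X\<close> for
  \<open>y\<close>.\<close>

lemma row_vec_mult_row_module:
  assumes "A \<in> carrier_mat n m" "X \<in> carrier_mat m n" "A * X * A = A"
    "y \<in> carrier (row_module A)"
  shows "row_vec_mult y (X * A) = y"
proof -
  obtain x where x: "x \<in> carrier_vec n" and y: "y = row_vec_mult x A"
    using row_module_memE[OF assms(4,1)] .
  show ?thesis
    using row_vec_mult_assoc[OF x assms(1) mult_carrier_mat[OF assms(2,1)]]
      assms(3) assoc_mult_mat[OF assms(1,2,1)] y by simp
qed

text \<open>Composed with the surjections from free modules, \<open>f\<close> and \<open>g\<close>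
  become matrices \<open>P\<close> and \<open>Q\<close>. The values of \<open>f\<close> lie in the
  row space of \<open>B\<close>, so \<open>f\<close> sends \<open>x A\<close> to
  \<open>(x P X) B\<close>; applying \<open>g\<close> gives \<open>A = P * X * Q\<close>. Inserting
  \<open>Q = B * X * Q\<close> exhibits \<open>B\<close> as a middle factor.\<close>

lemma row_module_retract_imp_mat_le:
  fixes A B :: "'a::ring_1 mat"
  assumes R: "von_neumann_regular TYPE('a)" and "module_retract (row_module A) (row_module B)"
  shows "mat_le A B"
proof -
  obtain n m where A: "A \<in> carrier_mat n m" by auto
  obtain k l where B: "B \<in> carrier_mat k l" by auto
  obtain f g where f: "f \<in> left_hom (row_module A) (row_module B)"
    and g: "g \<in> left_hom (row_module B) (row_module A)"
    and gf: "\<forall>x\<in>carrier (row_module A). g (f x) = x"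
    using assms(2) by (rule module_retractE)
  obtain X where X: "X \<in> carrier_mat l k" and BXB: "B * X * B = B"
    using von_neumann_regular_mat[OF R B] .
  have XB: "X * B \<in> carrier_mat l l" and BX: "B * X \<in> carrier_mat k k" using X B by auto
  \<comment> \<open>A map between row spaces is precomposed with the surjection \<open>x\<close> to
    \<open>x L\<close> and followed by the inclusion into the ambient free module; the result is a
    map of free modules and hence a matrix.\<close>
  have into: "(\<lambda>x. h (row_vec_mult x L)) \<in> left_hom (module_vec TYPE('a) i) (module_vec TYPE('a) j')"
    if L: "L \<in> carrier_mat i j" and L': "L' \<in> carrier_mat i' j'"
      and h: "h \<in> left_hom (row_module L) (row_module L')" for L L' :: "'a mat" and h i j i' j'
  proof -
    have "(\<lambda>x. row_vec_mult x L) \<in> left_hom (module_vec TYPE('a) i) (row_module L)"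
      using row_module_memI[OF _ L]
      by (intro left_hom_into_row_module[OF L row_vec_mult_hom[OF L]]) (simp add: module_vec_simps)
    moreover have "h \<in> left_hom (row_module L) (module_vec TYPE('a) j')"
      using h left_submodule_subset[OF row_module_submodule[OF L']]
      by (subst (asm) row_module_eq[OF L']) (rule left_hom_extend)
    ultimately show ?thesis by (rule left_hom_comp)
  qed
  obtain P where P: "P \<in> carrier_mat n l"
    and fP: "\<And>x. x \<in> carrier_vec n \<Longrightarrow> f (row_vec_mult x A) = row_vec_mult x P"
    using free_hom_matrix[OF into[OF A B f]] by blast
  obtain Q where Q: "Q \<in> carrier_mat k m"
    and gQ: "\<And>x. x \<in> carrier_vec k \<Longrightarrow> g (row_vec_mult x B) = row_vec_mult x Q"
    using free_hom_matrix[OF into[OF B A g]] by blast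
  have PX: "P * X \<in> carrier_mat n k" using P X by auto
  have XQ: "X * Q \<in> carrier_mat l m" using X Q by auto
  have fB: "f (row_vec_mult x A) = row_vec_mult (row_vec_mult x (P * X)) B"
    if x: "x \<in> carrier_vec n" for x
  proof -
    have "f (row_vec_mult x A) \<in> carrier (row_module B)"
      using left_homD(1)[OF f row_module_memI[OF x A]] .
    then have "f (row_vec_mult x A) = row_vec_mult (row_vec_mult x P) (X * B)"
      using row_vec_mult_row_module[OF B X BXB] fP[OF x] by metis
    also have "\<dots> = row_vec_mult x (P * X * B)"
      using row_vec_mult_assoc[OF x P XB] assoc_mult_mat[OF P X B] by simp
    finally show ?thesis using row_vec_mult_assoc[OF x PX B] by simp
  qed
  have "A = P * X * Q"
  proof (rule eq_mat_row_vec_multI[OF A mult_carrier_mat[OF PX Q]])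
    fix x :: "'a vec" assume x: "x \<in> carrier_vec n"
    have "row_vec_mult x A = g (f (row_vec_mult x A))"
      using gf row_module_memI[OF x A] by simp
    also have "\<dots> = row_vec_mult x (P * X * Q)"
      using fB[OF x] gQ[OF row_vec_mult_carrier[OF PX]] row_vec_mult_assoc[OF x PX Q] by simp
    finally show "row_vec_mult x A = row_vec_mult x (P * X * Q)" .
  qed
  \<comment> \<open>\<open>x Q\<close> depends only on \<open>x B\<close>, and \<open>x\<close> and
    \<open>x B X\<close> have the same product with \<open>B\<close>.\<close>
  moreover have "Q = B * X * Q"
  proof (rule eq_mat_row_vec_multI[OF Q mult_carrier_mat[OF BX Q]])
    fix x :: "'a vec" assume x: "x \<in> carrier_vec k"
    have "row_vec_mult x B = row_vec_mult (row_vec_mult x (B * X)) B"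
      using row_vec_mult_assoc[OF x BX B] BXB by simp
    then have "row_vec_mult x Q = row_vec_mult (row_vec_mult x (B * X)) Q"
      using gQ[OF x] gQ[OF row_vec_mult_carrier[OF BX]] by metis
    then show "row_vec_mult x Q = row_vec_mult x (B * X * Q)"
      using row_vec_mult_assoc[OF x BX Q] by simp
  qed
  ultimately have "A = P * X * (B * (X * Q))"
    using assoc_mult_mat[OF B X Q] by simp
  then have "A = P * X * B * (X * Q)"
    using assoc_mult_mat[OF PX B XQ] by simp
  then show ?thesis by (rule mat_leI[OF A B PX XQ])
qed

lemma row_module_retract_iff:
  fixes A B :: "'a::ring_1 mat"
  assumes "von_neumann_regular TYPE('a)"
  shows "module_retract (row_module A) (row_module B) \<longleftrightarrow> mat_le A B"
  using row_module_retract_imp_mat_le[OF assms] mat_le_imp_row_module_retract[OF assms] by blast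

text \<open>The kernel of \<open>x\<close> to \<open>x A\<close> is the row space of
  \<open>1 - A * X\<close>: this matrix is annihilated by \<open>A\<close> on the right, and it
  fixes every \<open>x\<close> with \<open>x A = 0\<close>.\<close>

lemma row_module_fin_presented:
  fixes A :: "'a::ring_1 mat"
  assumes R: "von_neumann_regular TYPE('a)"
  shows "fin_presented (row_module A)"
proof -
  obtain n m where A: "A \<in> carrier_mat n m" by auto
  obtain X where X: "X \<in> carrier_mat m n" and AXA: "A * X * A = A"
    using von_neumann_regular_mat[OF R A] .
  let ?E = "1\<^sub>m n - A * X"
  have AX: "A * X \<in> carrier_mat n n" using A X by auto
  have E: "?E \<in> carrier_mat n n" by (rule minus_carrier_mat[OF AX])
  have "(\<lambda>x. row_vec_mult x A) \<in> left_hom (module_vec TYPE('a) n) (row_module A)"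
    using row_module_memI[OF _ A]
    by (intro left_hom_into_row_module[OF A row_vec_mult_hom[OF A]]) (simp add: module_vec_simps)
  moreover have "(\<lambda>x. row_vec_mult x A) ` carrier_vec n = carrier (row_module A)"
    using A by (auto simp: row_module_simps)
  moreover have "row_vec_mult (row_vec_mult x ?E) A = 0\<^sub>v m" if x: "x \<in> carrier_vec n" for x
  proof -
    have xA: "row_vec_mult x A \<in> carrier_vec m" using A by auto
    have "?E * A = A - A"
      using minus_mult_distrib_mat[OF one_carrier_mat AX A] AXA A by simp
    then have "row_vec_mult (row_vec_mult x ?E) A = row_vec_mult x A - row_vec_mult x A"
      using row_vec_mult_assoc[OF x E A] row_vec_mult_minus[OF x A A] by simp
    then show ?thesis using xA by simp
  qed
  moreover have "x = row_vec_mult x ?E" if x: "x \<in> carrier_vec n" "row_vec_mult x A = 0\<^sub>v m" for x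
  proof -
    have "row_vec_mult x (A * X) = 0\<^sub>v n"
      using row_vec_mult_assoc[OF x(1) A X] x(2) X by (auto intro!: eq_vecI)
    then show ?thesis
      using row_vec_mult_minus[OF x(1) one_carrier_mat AX] row_vec_mult_one[OF x(1)] x(1) by simp
  qed
  ultimately have "right_exact (module_vec TYPE('a) n) (\<lambda>x. row_vec_mult x ?E)
      (module_vec TYPE('a) n) (\<lambda>x. row_vec_mult x A) (row_module A)"
    using row_vec_mult_hom[OF E] row_vec_mult_carrier[OF E] A
    unfolding right_exact_def a_kernel_def'
    by (auto simp: module_vec_simps row_module_simps(3))
  then show ?thesis
    unfolding fin_presented_def using left_module_row_module by blast
qed

text \<open>If \<open>F\<close> presents \<open>M\<close> and \<open>F X F = F\<close>, then \<open>1 - X F\<close> projects onto a complement of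
  the row space of \<open>F\<close>.\<close>

lemma fin_presented_row_module:
  fixes M :: "('a::ring_1, 'b, 'm) module_scheme"
  assumes R: "von_neumann_regular TYPE('a)" and M: "fin_presented M"
  obtains m and E :: "'a mat" where "E \<in> carrier_mat m m" "E * E = E"
    "left_isomorphic (row_module E) M"
proof -
  have lM: "left_module M" using M by (simp add: fin_presented_def)
  obtain n m f g where ex: "right_exact (module_vec TYPE('a) n) f (module_vec TYPE('a) m) g M"
    using M by (auto simp: fin_presented_def)
  have f: "f \<in> left_hom (module_vec TYPE('a) n) (module_vec TYPE('a) m)"
    and g: "g \<in> left_hom (module_vec TYPE('a) m) M"
    and ker: "f ` carrier_vec n = {x \<in> carrier_vec m. g x = \<zero>\<^bsub>M\<^esub>}"
    and sur: "g ` carrier_vec m = carrier M"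
    using ex by (auto simp: right_exact_def a_kernel_def' module_vec_simps)
  obtain F where F: "F \<in> carrier_mat n m"
    and fF: "\<And>x. x \<in> carrier_vec n \<Longrightarrow> f x = row_vec_mult x F"
    using free_hom_matrix[OF f] by blast
  obtain X where X: "X \<in> carrier_mat m n" and FXF: "F * X * F = F"
    using von_neumann_regular_mat[OF R F] .
  have XF: "X * F \<in> carrier_mat m m" using X F by auto
  define E where "E = 1\<^sub>m m - X * F"
  have E: "E \<in> carrier_mat m m" unfolding E_def by (rule minus_carrier_mat[OF XF])
  have FE: "F * E = 0\<^sub>m n m"
    using mult_minus_distrib_mat[OF F one_carrier_mat XF] assoc_mult_mat[OF F X F] FXF F
    by (simp add: E_def)
  have "E * E = 1\<^sub>m m * E - X * F * E"
    using minus_mult_distrib_mat[OF one_carrier_mat XF E] by (simp add: E_def)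
  also have "\<dots> = E - 0\<^sub>m m m"
    using assoc_mult_mat[OF X F E] FE X E by simp
  also have "\<dots> = E" using E by (intro eq_matI) auto
  finally have EE: "E * E = E" .
  have xE: "row_vec_mult x E = x - row_vec_mult x (X * F)" if "x \<in> carrier_vec m" for x
    using row_vec_mult_minus[OF that one_carrier_mat XF] row_vec_mult_one[OF that] by (simp add: E_def)
  have gXF: "g (row_vec_mult x (X * F)) = \<zero>\<^bsub>M\<^esub>" if x: "x \<in> carrier_vec m" for x
  proof -
    have "row_vec_mult x (X * F) = f (row_vec_mult x X)"
      using row_vec_mult_assoc[OF x X F] fF[OF row_vec_mult_carrier[OF X]] by simp
    then show ?thesis using ker row_vec_mult_carrier[OF X, of x] by blast
  qed
  interpret M: left_module M by fact
  \<comment> \<open>\<open>x\<close> and \<open>x E\<close> differ by \<open>x X F\<close>, which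
    lies in the image of \<open>f\<close>. So \<open>g\<close> stays surjective on the row space of
    \<open>E\<close>.\<close>
  have gE: "g (row_vec_mult x E) = g x" if x: "x \<in> carrier_vec m" for x
  proof -
    have c: "row_vec_mult x E \<in> carrier_vec m" "row_vec_mult x (X * F) \<in> carrier_vec m"
      using E XF by auto
    have "g x = g (row_vec_mult x E + row_vec_mult x (X * F))"
      unfolding xE[OF x] using x c(2) F by (intro arg_cong[of _ _ g] eq_vecI) auto
    also have "\<dots> = g (row_vec_mult x E) \<oplus>\<^bsub>M\<^esub> g (row_vec_mult x (X * F))"
      using left_homD(2)[OF g] c by (simp add: module_vec_simps)
    finally show ?thesis
      using gXF[OF x] left_homD(1)[OF g] c by (simp add: module_vec_simps)
  qed
  have sub: "carrier (row_module E) \<subseteq> carrier_vec m"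
    using E by (auto simp: row_module_simps)
  have gR: "g \<in> left_hom (row_module E) M"
    using g sub by (subst row_module_eq[OF E]) (auto intro!: left_hom_restrict simp: module_vec_simps)
  \<comment> \<open>A kernel element is some \<open>z F\<close>, and in the row space of
    \<open>E\<close> it is fixed by the idempotent \<open>E\<close>; since \<open>F * E = 0\<close>,
    it vanishes.\<close>
  have ker0: "y = 0\<^sub>v m" if y: "y \<in> carrier (row_module E)" "g y = \<zero>\<^bsub>M\<^esub>" for y
  proof -
    have "y \<in> carrier_vec m" using y sub by auto
    with y ker obtain z where z: "z \<in> carrier_vec n" "y = row_vec_mult z F"
      using fF by (metis (mono_tags, lifting) imageE mem_Collect_eq)
    obtain x where x: "x \<in> carrier_vec m" "y = row_vec_mult x E"
      using row_module_memE[OF y(1) E] .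
    have "y = row_vec_mult y E"
      using row_vec_mult_assoc[OF x(1) E E] EE x(2) by simp
    also have "\<dots> = row_vec_mult z (0\<^sub>m n m)"
      using row_vec_mult_assoc[OF z(1) F E] FE z(2) by simp
    also have "\<dots> = 0\<^sub>v m" using z by (intro eq_vecI) auto
    finally show ?thesis .
  qed
  interpret E: left_module "row_module E" by (rule left_module_row_module)
  have inj: "inj_on g (carrier (row_module E))"
  proof (rule inj_onI)
    fix x y assume xy: "x \<in> carrier (row_module E)" "y \<in> carrier (row_module E)" "g x = g y"
    let ?d = "x \<oplus>\<^bsub>row_module E\<^esub> ((- 1) \<odot>\<^bsub>row_module E\<^esub> y)"
    have "g ?d = g x \<oplus>\<^bsub>M\<^esub> ((- 1) \<odot>\<^bsub>M\<^esub> g y)"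
      using left_homD(2,3)[OF gR] xy E.smult_closed by simp
    also have "\<dots> = \<zero>\<^bsub>M\<^esub>"
      using left_homD(1)[OF gR xy(2)] xy(3) by (simp add: M.smult_minus_one M.r_neg)
    finally have "?d = \<zero>\<^bsub>row_module E\<^esub>"
      using ker0[of ?d] xy E.smult_closed E by (simp add: row_module_simps(3))
    then have "x \<oplus>\<^bsub>row_module E\<^esub> (\<ominus>\<^bsub>row_module E\<^esub> y) = \<zero>\<^bsub>row_module E\<^esub>"
      using xy E.smult_minus_one by simp
    then show "x = y" using xy by (metis E.minus_equality E.minus_minus E.a_inv_closed)
  qed
  have "g ` carrier (row_module E) = carrier M"
  proof
    show "g ` carrier (row_module E) \<subseteq> carrier M" using left_homD(1)[OF gR] by auto
    show "carrier M \<subseteq> g ` carrier (row_module E)"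
    proof
      fix y assume "y \<in> carrier M"
      then obtain x where x: "x \<in> carrier_vec m" "y = g x" using sur by blast
      then show "y \<in> g ` carrier (row_module E)"
        using gE[OF x(1)] row_module_memI[OF x(1) E] by (intro image_eqI[of _ _ "row_vec_mult x E"]) auto
    qed
  qed
  with inj gR have "left_isomorphic (row_module E) M"
    unfolding left_isomorphic_def bij_betw_def by blast
  with E EE show thesis by (rule that)
qed

lemma fin_presented_imp_free_retract:
  fixes M :: "('a::ring_1, 'b, 'm) module_scheme"
  assumes R: "von_neumann_regular TYPE('a)" and M: "fin_presented M"
  obtains m where "module_retract M (module_vec TYPE('a) m)"
proof -
  obtain m and E :: "'a mat" where E: "E \<in> carrier_mat m m" and EE: "E * E = E"
    and iso: "left_isomorphic (row_module E) M"
    using fin_presented_row_module[OF R M] .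
  have "module_retract (row_module E) (module_vec TYPE('a) m)"
  proof (rule module_retractI)
    \<comment> \<open>The inclusion of the row space, written as a product so that
      \<open>row_module_hom\<close> applies.\<close>
    show "(\<lambda>y. row_vec_mult y (1\<^sub>m m)) \<in> left_hom (row_module E) (module_vec TYPE('a) m)"
      by (rule row_module_hom[OF E one_carrier_mat])
    show "(\<lambda>y. row_vec_mult y E) \<in> left_hom (module_vec TYPE('a) m) (row_module E)"
      using row_module_memI[OF _ E]
      by (intro left_hom_into_row_module[OF E row_vec_mult_hom[OF E]]) (simp add: module_vec_simps)
    fix y assume "y \<in> carrier (row_module E)"
    then obtain x where x: "x \<in> carrier_vec m" "y = row_vec_mult x E"
      using row_module_memE[OF _ E] by blast
    then have "y \<in> carrier_vec m" using E by auto
    then show "row_vec_mult (row_vec_mult y (1\<^sub>m m)) E = y"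
      using row_vec_mult_assoc[OF x(1) E E] EE x(2) by (simp add: row_vec_mult_one)
  qed
  with left_isomorphic_imp_retract(2)[OF left_module_row_module iso] show thesis
    by (rule that[OF module_retract_trans])
qed

text \<open>The components are first chosen pointwise. Trivial intersection makes them unique, and
  uniqueness makes the choice functions linear.\<close>

lemma internal_direct_sum_projections:
  assumes N: "left_module N" and sum: "internal_direct_sum N S T"
  obtains p q where "p \<in> left_hom N (N\<lparr>carrier := S\<rparr>)" "q \<in> left_hom N (N\<lparr>carrier := T\<rparr>)"
    "\<And>x y. x \<in> S \<Longrightarrow> y \<in> T \<Longrightarrow> p (x \<oplus>\<^bsub>N\<^esub> y) = x"
    "\<And>x y. x \<in> S \<Longrightarrow> y \<in> T \<Longrightarrow> q (x \<oplus>\<^bsub>N\<^esub> y) = y"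
proof -
  interpret N: left_module N by fact
  have S: "left_submodule N S" and T: "left_submodule N T"
    and dec: "S <+>\<^bsub>N\<^esub> T = carrier N" and int: "S \<inter> T = {\<zero>\<^bsub>N\<^esub>}"
    using sum by (auto simp: internal_direct_sum_def)
  note subS = left_submodule_subset[OF S, THEN subsetD] and subT = left_submodule_subset[OF T, THEN subsetD]
  note clS = left_submoduleD[OF S] and clT = left_submoduleD[OF T]
  have "\<exists>s t. s \<in> S \<and> t \<in> T \<and> s \<oplus>\<^bsub>N\<^esub> t = x" if "x \<in> carrier N" for x
    using that unfolding dec[symmetric] set_add_def' by auto
  then obtain p q where pS: "\<And>x. x \<in> carrier N \<Longrightarrow> p x \<in> S" and qT: "\<And>x. x \<in> carrier N \<Longrightarrow> q x \<in> T"
    and pq: "\<And>x. x \<in> carrier N \<Longrightarrow> p x \<oplus>\<^bsub>N\<^esub> q x = x"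
    by metis
  have uniq: "s = s' \<and> t = t'"
    if st: "s \<in> S" "s' \<in> S" "t \<in> T" "t' \<in> T" and eq: "s \<oplus>\<^bsub>N\<^esub> t = s' \<oplus>\<^bsub>N\<^esub> t'" for s s' t t'
  proof -
    have c: "s \<in> carrier N" "s' \<in> carrier N" "t \<in> carrier N" "t' \<in> carrier N"
      using st subS subT by auto
    \<comment> \<open>The difference of the \<open>S\<close>-components is also the difference of
      the \<open>T\<close>-components in the opposite order, hence lies in both summands.\<close>
    let ?d = "\<ominus>\<^bsub>N\<^esub> s' \<oplus>\<^bsub>N\<^esub> s"
    have "?d \<oplus>\<^bsub>N\<^esub> t = \<ominus>\<^bsub>N\<^esub> s' \<oplus>\<^bsub>N\<^esub> (s' \<oplus>\<^bsub>N\<^esub> t')"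
      using c by (simp add: N.a_assoc eq)
    also have "\<dots> = t'" using c by (simp add: N.r_neg1)
    finally have dt: "?d \<oplus>\<^bsub>N\<^esub> t = t'" .
    then have "?d = t' \<oplus>\<^bsub>N\<^esub> \<ominus>\<^bsub>N\<^esub> t"
      using c by (metis N.a_assoc N.a_inv_closed N.r_neg N.r_zero N.add.m_closed)
    then have "?d \<in> T" using clT st by simp
    moreover have "?d \<in> S" using clS st by simp
    ultimately have d: "?d = \<zero>\<^bsub>N\<^esub>" using int by blast
    then have "s = s'" using c by (metis N.minus_equality N.minus_minus N.a_inv_closed N.a_comm)
    moreover have "t = t'" using dt d c by simp
    ultimately show ?thesis ..
  qed
  have pq_eq: "p (s \<oplus>\<^bsub>N\<^esub> t) = s" "q (s \<oplus>\<^bsub>N\<^esub> t) = t" if "s \<in> S" "t \<in> T" for s t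
    using uniq[OF pS that(1) qT that(2) pq] that subS subT by auto
  have "p (x \<oplus>\<^bsub>N\<^esub> y) = p x \<oplus>\<^bsub>N\<^esub> p y \<and> q (x \<oplus>\<^bsub>N\<^esub> y) = q x \<oplus>\<^bsub>N\<^esub> q y"
    if xy: "x \<in> carrier N" "y \<in> carrier N" for x y
  proof -
    have c: "p x \<in> carrier N" "p y \<in> carrier N" "q x \<in> carrier N" "q y \<in> carrier N"
      using pS qT xy subS subT by auto
    have "x \<oplus>\<^bsub>N\<^esub> y = (p x \<oplus>\<^bsub>N\<^esub> q x) \<oplus>\<^bsub>N\<^esub> (p y \<oplus>\<^bsub>N\<^esub> q y)" using pq xy by simp
    also have "\<dots> = (p x \<oplus>\<^bsub>N\<^esub> p y) \<oplus>\<^bsub>N\<^esub> (q x \<oplus>\<^bsub>N\<^esub> q y)" using c by (simp add: N.a_ac)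
    finally show ?thesis
      using pq_eq[of "p x \<oplus>\<^bsub>N\<^esub> p y" "q x \<oplus>\<^bsub>N\<^esub> q y"] clS(2) clT(2) pS qT xy by simp
  qed
  moreover have "p (a \<odot>\<^bsub>N\<^esub> x) = a \<odot>\<^bsub>N\<^esub> p x \<and> q (a \<odot>\<^bsub>N\<^esub> x) = a \<odot>\<^bsub>N\<^esub> q x"
    if x: "x \<in> carrier N" for a x
  proof -
    have c: "p x \<in> carrier N" "q x \<in> carrier N"
      using pS qT x subS subT by auto
    have "a \<odot>\<^bsub>N\<^esub> x = a \<odot>\<^bsub>N\<^esub> (p x \<oplus>\<^bsub>N\<^esub> q x)" using pq x by simp
    also have "\<dots> = a \<odot>\<^bsub>N\<^esub> p x \<oplus>\<^bsub>N\<^esub> a \<odot>\<^bsub>N\<^esub> q x" using c by (rule N.smult_r_distr)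
    finally show ?thesis
      using pq_eq[of "a \<odot>\<^bsub>N\<^esub> p x" "a \<odot>\<^bsub>N\<^esub> q x"] clS(3) clT(3) pS qT x by simp
  qed
  ultimately have "p \<in> left_hom N (N\<lparr>carrier := S\<rparr>)" "q \<in> left_hom N (N\<lparr>carrier := T\<rparr>)"
    using pS qT by (auto simp: left_hom_def)
  then show thesis using pq_eq by (rule that)
qed

section \<open>The module preorder\<close>

text \<open>The quotient \<open>T\<close> of \<open>M\<close> is projective, which gives a section of \<open>g\<close>. The image of \<open>f\<close> is, inside a
  free module containing \<open>M\<close>, the row space of a matrix \<open>F\<close>, and multiplication by a quasi-inverse of
  \<open>F\<close> gives a section of \<open>f\<close>.\<close>

lemma mod_lesssim_imp_retract:
  fixes M :: "('a::ring_1, 'b, 'm) module_scheme" and N :: "('a, 'c, 'n) module_scheme"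
  assumes R: "von_neumann_regular TYPE('a)" and "mod_lesssim M N"
  shows "module_retract M N"
proof -
  obtain S T f g where fpM: "fin_presented M" and fpN: "fin_presented N"
    and sum: "internal_direct_sum N S T"
    and ex: "right_exact (N\<lparr>carrier := S\<rparr>) f M g (N\<lparr>carrier := T\<rparr>)"
    using assms(2) unfolding mod_lesssim_def by blast
  have M: "left_module M" and N: "left_module N"
    using fpM fpN by (simp_all add: fin_presented_def)
  interpret M: left_module M by fact
  interpret N: left_module N by fact
  have S: "left_submodule N S" and T: "left_submodule N T"
    using sum by (simp_all add: internal_direct_sum_def)
  note subS = left_submodule_subset[OF S] and subT = left_submodule_subset[OF T]
  have f: "f \<in> left_hom (N\<lparr>carrier := S\<rparr>) M" and g: "g \<in> left_hom M (N\<lparr>carrier := T\<rparr>)"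
    and fS: "f ` S = {x \<in> carrier M. g x = \<zero>\<^bsub>N\<^esub>}" and gM: "g ` carrier M = T"
    using ex by (auto simp: right_exact_def a_kernel_def')
  obtain p q where p: "p \<in> left_hom N (N\<lparr>carrier := S\<rparr>)" and q: "q \<in> left_hom N (N\<lparr>carrier := T\<rparr>)"
    and pq: "\<And>x y. x \<in> S \<Longrightarrow> y \<in> T \<Longrightarrow> p (x \<oplus>\<^bsub>N\<^esub> y) = x"
      "\<And>x y. x \<in> S \<Longrightarrow> y \<in> T \<Longrightarrow> q (x \<oplus>\<^bsub>N\<^esub> y) = y"
    using internal_direct_sum_projections[OF N sum] by metis
  have pS: "p x = x" if "x \<in> S" for x
    using pq(1)[OF that left_submoduleD(1)[OF T]] that subS by auto
  have qT: "q x = x" if "x \<in> T" for x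
    using pq(2)[OF left_submoduleD(1)[OF S] that] that subT by auto
  obtain k where "module_retract N (module_vec TYPE('a) k)"
    using fin_presented_imp_free_retract[OF R fpN] .
  then obtain i j where i: "i \<in> left_hom N (module_vec TYPE('a) k)"
    and j: "j \<in> left_hom (module_vec TYPE('a) k) N" and ji: "\<forall>x\<in>carrier N. j (i x) = x"
    by (rule module_retractE)
  obtain m where "module_retract M (module_vec TYPE('a) m)"
    using fin_presented_imp_free_retract[OF R fpM] .
  then obtain i' j' where i': "i' \<in> left_hom M (module_vec TYPE('a) m)"
    and j': "j' \<in> left_hom (module_vec TYPE('a) m) M" and ji': "\<forall>x\<in>carrier M. j' (i' x) = x"
    by (rule module_retractE)
  note ic = left_homD(1)[OF i, unfolded module_vec_simps]
  note ic' = left_homD(1)[OF i', unfolded module_vec_simps]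
  \<comment> \<open>\<open>T\<close> is a retract of a free module by way of \<open>N\<close>;
    lifting \<open>q\<close> after \<open>j\<close> along \<open>g\<close> gives \<open>l\<close>,
    and \<open>l\<close> after \<open>i\<close> is a section of \<open>g\<close> on
    \<open>T\<close>.\<close>
  obtain l where l: "l \<in> left_hom (module_vec TYPE('a) k) M"
    and gl: "\<And>x. x \<in> carrier_vec k \<Longrightarrow> g (l x) = q (j x)"
    using free_hom_lift[OF M left_submodule_left_module[OF N T] g _ left_hom_comp[OF j q]] gM by auto
  have li: "(\<lambda>x. l (i x)) \<in> left_hom N M" by (rule left_hom_comp[OF i l])
  have gli: "g (l (i x)) = x" if "x \<in> T" for x
    using gl[OF ic] ji qT[OF that] that subT by auto
  \<comment> \<open>\<open>f\<close> is transported to the free modules around \<open>N\<close> and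
    \<open>M\<close>, with \<open>p\<close> extending it from \<open>S\<close> to \<open>N\<close>,
    so that it becomes a matrix with a quasi-inverse.\<close>
  obtain F where F: "F \<in> carrier_mat k m"
    and uF: "\<And>x. x \<in> carrier_vec k \<Longrightarrow> i' (f (p (j x))) = row_vec_mult x F"
    using free_hom_matrix[OF left_hom_comp[OF left_hom_comp[OF left_hom_comp[OF j p] f] i']] by blast
  obtain X where X: "X \<in> carrier_mat m k" and FXF: "F * X * F = F"
    using von_neumann_regular_mat[OF R F] .
  \<comment> \<open>\<open>X\<close> carried back from the free modules and projected to
    \<open>S\<close>. On the image of \<open>f\<close> it is a section, because \<open>i'\<close> is
    injective and \<open>F * X * F = F\<close>.\<close>
  define r where "r y = p (j (row_vec_mult (i' y) X))" for y
  have r: "r \<in> left_hom M (N\<lparr>carrier := S\<rparr>)"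
    unfolding r_def
    by (rule left_hom_comp[OF left_hom_comp[OF left_hom_comp[OF i' row_vec_mult_hom[OF X]] j] p])
  have fr: "f (r y) = y" if y: "y \<in> f ` S" for y
  proof -
    obtain z where z: "z \<in> S" "y = f z" using y by blast
    then have zN: "z \<in> carrier N" and iz: "i z \<in> carrier_vec k" using subS ic by auto
    have yM: "y \<in> carrier M" using left_homD(1)[OF f, of z] z by simp
    have iy: "i' y = row_vec_mult (i z) F"
      using uF[OF iz] ji zN pS z by simp
    have "i' (f (r y)) = row_vec_mult (row_vec_mult (i' y) X) F"
      unfolding r_def by (rule uF[OF row_vec_mult_carrier[OF X]])
    also have "\<dots> = row_vec_mult (i z) (F * X * F)"
      unfolding iy using row_vec_mult_assoc[OF iz F X]
        row_vec_mult_assoc[OF iz mult_carrier_mat[OF F X] F] by simp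
    finally have "i' (f (r y)) = i' y" using FXF iy by simp
    moreover have "f (r y) \<in> carrier M"
      using left_homD(1)[OF f] left_homD(1)[OF r yM] by simp
    ultimately show ?thesis using ji' yM by metis
  qed
  \<comment> \<open>Removing the part of \<open>y\<close> lifted from \<open>T\<close> leaves an
    element of the kernel of \<open>g\<close>, which by exactness is the image of
    \<open>f\<close>.\<close>
  define e where "e y = y \<ominus>\<^bsub>M\<^esub> l (i (g y))" for y
  have gN: "g \<in> left_hom M N" using left_hom_extend[OF g subT] .
  have rN: "r \<in> left_hom M N" using left_hom_extend[OF r subS] .
  have gT: "g y \<in> T" if "y \<in> carrier M" for y
    using gM that by blast
  have lig: "(\<lambda>y. l (i (g y))) \<in> left_hom M M"
    by (rule left_hom_comp[OF gN li])
  have e: "e \<in> left_hom M M"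
    unfolding e_def by (rule left_hom_diff[OF M M left_hom_id lig])
  have eS: "e y \<in> f ` S" if y: "y \<in> carrier M" for y
  proof -
    have c: "l (i (g y)) \<in> carrier M" "g y \<in> carrier N"
      using left_homD(1)[OF lig y] left_homD(1)[OF gN y] by auto
    have "g (e y \<oplus>\<^bsub>M\<^esub> l (i (g y))) = g (e y) \<oplus>\<^bsub>N\<^esub> g (l (i (g y)))"
      using left_homD(2)[OF gN left_homD(1)[OF e y] c(1)] .
    moreover have "e y \<oplus>\<^bsub>M\<^esub> l (i (g y)) = y"
      unfolding e_def using y c by (simp add: a_minus_def M.a_assoc M.l_neg)
    ultimately have "g y = g (e y) \<oplus>\<^bsub>N\<^esub> g y"
      using gli[OF gT[OF y]] by simp
    then have "g (e y) = \<zero>\<^bsub>N\<^esub>"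
      using N.add.l_cancel_one[OF c(2), of "g (e y)"] left_homD(1)[OF gN left_homD(1)[OF e y]]
      by (metis N.a_comm c(2))
    then show ?thesis unfolding fS using left_homD(1)[OF e y] by simp
  qed
  \<comment> \<open>\<open>?\<phi>\<close> records the kernel part of \<open>y\<close> in
    \<open>S\<close> and its image under \<open>g\<close> in \<open>T\<close>;
    \<open>?\<gamma>\<close> reassembles \<open>y\<close> from the two components.\<close>
  let ?\<phi> = "\<lambda>y. r (e y) \<oplus>\<^bsub>N\<^esub> g y"
  let ?\<gamma> = "\<lambda>x. f (p x) \<oplus>\<^bsub>M\<^esub> l (i (q x))"
  show ?thesis
  proof (rule module_retractI)
    show "?\<phi> \<in> left_hom M N"
      by (rule left_hom_add[OF M N left_hom_comp[OF e rN] gN])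
    show "?\<gamma> \<in> left_hom N M"
      by (rule left_hom_add[OF N M left_hom_comp[OF p f] left_hom_comp[OF left_hom_extend[OF q subT] li]])
    fix y assume y: "y \<in> carrier M"
    have c: "l (i (g y)) \<in> carrier M" "r (e y) \<in> S"
      using left_homD(1)[OF lig y] left_homD(1)[OF r left_homD(1)[OF e y]] by auto
    have "?\<gamma> (?\<phi> y) = f (r (e y)) \<oplus>\<^bsub>M\<^esub> l (i (g y))"
      using pq[OF c(2) gT[OF y]] by simp
    also have "\<dots> = e y \<oplus>\<^bsub>M\<^esub> l (i (g y))" using fr[OF eS[OF y]] by simp
    also have "\<dots> = y"
      unfolding e_def using y c by (simp add: a_minus_def M.a_assoc M.l_neg)
    finally show "?\<gamma> (?\<phi> y) = y" .
  qed
qed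

text \<open>\<open>N\<close> splits as the kernel of \<open>g\<close> plus the image of
  \<open>f\<close>. The zero map from the first summand and \<open>f\<close> onto the second form
  the required sequence, exact because \<open>f\<close> is injective.\<close>

lemma retract_imp_mod_lesssim:
  assumes fpM: "fin_presented M" and fpN: "fin_presented N" and "module_retract M N"
  shows "mod_lesssim M N"
proof -
  obtain f g where f: "f \<in> left_hom M N" and g: "g \<in> left_hom N M"
    and gf: "\<forall>x\<in>carrier M. g (f x) = x"
    using assms(3) by (rule module_retractE)
  have M: "left_module M" and N: "left_module N"
    using fpM fpN by (simp_all add: fin_presented_def)
  interpret M: left_module M by fact
  interpret N: left_module N by fact
  note f0 = left_hom_zero[OF M N f] and g0 = left_hom_zero[OF N M g]
  let ?S = "{x \<in> carrier N. g x = \<zero>\<^bsub>M\<^esub>}" and ?T = "f ` carrier M"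
  note fD = left_homD[OF f] and gD = left_homD[OF g]
  have S: "left_submodule N ?S"
    by (rule left_submoduleI[OF N]) (auto simp: gD g0 N.smult_closed M.smult_zero)
  have T: "left_submodule N ?T"
    by (rule left_submoduleI[OF N])
       (auto simp: fD f0[symmetric] M.smult_closed simp flip: fD(2,3))
  have "x \<in> ?S <+>\<^bsub>N\<^esub> ?T" if x: "x \<in> carrier N" for x
  proof -
    have c: "f (g x) \<in> carrier N" "g x \<in> carrier M" using x fD(1) gD(1) by auto
    let ?s = "x \<ominus>\<^bsub>N\<^esub> f (g x)"
    have s: "?s \<in> carrier N" using x c by simp
    have xs: "?s \<oplus>\<^bsub>N\<^esub> f (g x) = x"
      using x c by (simp add: a_minus_def N.a_assoc N.l_neg)
    have "g ?s \<oplus>\<^bsub>M\<^esub> g (f (g x)) = g x"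
      using gD(2)[OF s c(1)] xs by simp
    then have "g ?s \<oplus>\<^bsub>M\<^esub> g x = g x" using gf c by simp
    then have "g ?s = \<zero>\<^bsub>M\<^esub>"
      using gD(1)[OF s] c(2) by (metis M.a_comm M.add.r_cancel_one)
    then have "?s \<in> ?S" "f (g x) \<in> ?T" using s c by auto
    then show ?thesis using xs unfolding set_add_def' by (metis (no_types, lifting) UN_I singletonI)
  qed
  moreover have "?S <+>\<^bsub>N\<^esub> ?T \<subseteq> carrier N"
    unfolding set_add_def' by (auto simp: fD(1))
  moreover have "?S \<inter> ?T = {\<zero>\<^bsub>N\<^esub>}"
  proof
    show "?S \<inter> ?T \<subseteq> {\<zero>\<^bsub>N\<^esub>}" using gf f0 by auto
    show "{\<zero>\<^bsub>N\<^esub>} \<subseteq> ?S \<inter> ?T" using left_submoduleD(1)[OF S] left_submoduleD(1)[OF T] by blast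
  qed
  ultimately have "internal_direct_sum N ?S ?T"
    using S T unfolding internal_direct_sum_def by blast
  moreover have "right_exact (N\<lparr>carrier := ?S\<rparr>) (\<lambda>_. \<zero>\<^bsub>M\<^esub>) M f (N\<lparr>carrier := ?T\<rparr>)"
  proof -
    have "a_kernel M (N\<lparr>carrier := ?T\<rparr>) f = {\<zero>\<^bsub>M\<^esub>}"
      unfolding a_kernel_def' using gf f0 g0 by force
    moreover have "(\<lambda>_. \<zero>\<^bsub>M\<^esub>) ` ?S = {\<zero>\<^bsub>M\<^esub>}"
      using left_submoduleD(1)[OF S] by blast
    moreover have "(\<lambda>_. \<zero>\<^bsub>M\<^esub>) \<in> left_hom (N\<lparr>carrier := ?S\<rparr>) M"
      by (auto simp: left_hom_def M.smult_zero)
    moreover have "f \<in> left_hom M (N\<lparr>carrier := ?T\<rparr>)"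
      using f by (auto simp: left_hom_def)
    ultimately show ?thesis by (simp add: right_exact_def)
  qed
  ultimately show ?thesis
    unfolding mod_lesssim_def using fpM fpN by blast
qed

lemma mod_preceq_iff:
  fixes M N :: "('a::ring_1, 'a vec) module"
  assumes R: "von_neumann_regular TYPE('a)" and "M \<in> fp_mods" "N \<in> fp_mods"
  shows "mod_preceq M N \<longleftrightarrow> module_retract M N"
proof
  assume "mod_preceq M N"
  then have "mod_lesssim\<^sup>*\<^sup>* M N" unfolding mod_preceq_def .
  then show "module_retract M N"
  proof (induction rule: rtranclp_induct)
    case base
    show ?case by (rule module_retract_refl)
  next
    case (step N L)
    from step.IH mod_lesssim_imp_retract[OF R step.hyps(2)] show ?case by (rule module_retract_trans)
  qed
next
  assume "module_retract M N"
  then show "mod_preceq M N"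
    using assms unfolding mod_preceq_def fp_mods_def by (blast intro: retract_imp_mod_lesssim)
qed

text \<open>Since retracts compose across types, all representatives of \<open>M\<close> have the
  same retract relations as \<open>M\<close> itself. Classes of modules on other types, such as
  direct sums on pairs, are thereby handled without naming a representative.\<close>

lemma mod_class_eq_retract:
  fixes M :: "('a::ring_1, 'b, 'm) module_scheme"
  assumes R: "von_neumann_regular TYPE('a)" and M: "fin_presented M"
  shows "mod_class M = {N \<in> fp_mods. module_retract M N \<and> module_retract N M}"
proof -
  have iso: "module_retract K M" "module_retract M K" if "K \<in> fp_mods" "left_isomorphic K M" for K
  proof -
    have "left_module K" using that(1) by (simp add: fp_mods_def fin_presented_def)
    from left_isomorphic_imp_retract[OF this that(2)]
    show "module_retract K M" "module_retract M K" .
  qed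
  have "N \<in> mod_equiv `` {K} \<longleftrightarrow> N \<in> fp_mods \<and> module_retract M N \<and> module_retract N M"
    if K: "K \<in> fp_mods" "left_isomorphic K M" for K N
  proof -
    have "N \<in> mod_equiv `` {K} \<longleftrightarrow> N \<in> fp_mods \<and> module_retract K N \<and> module_retract N K"
      using mod_preceq_iff[OF R K(1), of N] mod_preceq_iff[OF R _ K(1), of N] K(1)
      unfolding mod_equiv_def by blast
    also have "\<dots> \<longleftrightarrow> N \<in> fp_mods \<and> module_retract M N \<and> module_retract N M"
      using iso[OF K] module_retract_trans[of M K N] module_retract_trans[of N K M]
        module_retract_trans[of K M N] module_retract_trans[of N M K] by blast
    finally show ?thesis .
  qed
  moreover obtain K where "K \<in> fp_mods" "left_isomorphic K M"
    using fin_presented_representative[OF M] by blast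
  ultimately show ?thesis unfolding mod_class_def by blast
qed

lemma mod_class_cong:
  fixes M :: "('a::ring_1, 'b, 'm) module_scheme" and N :: "('a, 'c, 'n) module_scheme"
  assumes "left_module M" "left_module N" "left_isomorphic M N"
  shows "mod_class M = mod_class N"
proof -
  have "left_isomorphic K M \<longleftrightarrow> left_isomorphic K N" for K :: "('a, 'a vec) module"
    using left_isomorphic_trans[OF _ assms(3), of K]
      left_isomorphic_trans[OF _ left_isomorphic_sym[OF assms(1,3)], of K] by blast
  then show ?thesis by (simp add: mod_class_def)
qed

lemma left_isomorphic_trivial:
  assumes "left_module M" "left_module N" "carrier M = {\<zero>\<^bsub>M\<^esub>}" "carrier N = {\<zero>\<^bsub>N\<^esub>}"
  shows "left_isomorphic M N"
proof -
  interpret N: left_module N by fact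
  have "(\<lambda>_. \<zero>\<^bsub>N\<^esub>) \<in> left_hom M N"
    by (auto simp: left_hom_def N.smult_zero)
  moreover have "bij_betw (\<lambda>_. \<zero>\<^bsub>N\<^esub>) (carrier M) (carrier N)"
    by (simp add: assms(3,4) bij_betw_def)
  ultimately show ?thesis unfolding left_isomorphic_def by blast
qed

section \<open>Direct sums\<close>

lemma direct_sum_simps:
  "carrier (direct_sum M N) = carrier M \<times> carrier N"
  "(x, y) \<oplus>\<^bsub>direct_sum M N\<^esub> (x', y') = (x \<oplus>\<^bsub>M\<^esub> x', y \<oplus>\<^bsub>N\<^esub> y')"
  "\<zero>\<^bsub>direct_sum M N\<^esub> = (\<zero>\<^bsub>M\<^esub>, \<zero>\<^bsub>N\<^esub>)"
  "a \<odot>\<^bsub>direct_sum M N\<^esub> (x, y) = (a \<odot>\<^bsub>M\<^esub> x, a \<odot>\<^bsub>N\<^esub> y)"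
  by (simp_all add: direct_sum_def)

lemma left_module_direct_sum:
  assumes "left_module M" "left_module N"
  shows "left_module (direct_sum M N)"
proof -
  interpret M: left_module M by fact
  interpret N: left_module N by fact
  have "abelian_group (direct_sum M N)"
  proof (rule abelian_groupI)
    fix z assume "z \<in> carrier (direct_sum M N)"
    then obtain x y where z: "z = (x, y)" "x \<in> carrier M" "y \<in> carrier N"
      by (auto simp: direct_sum_simps)
    then show "\<exists>w\<in>carrier (direct_sum M N). w \<oplus>\<^bsub>direct_sum M N\<^esub> z = \<zero>\<^bsub>direct_sum M N\<^esub>"
      by (intro bexI[of _ "(\<ominus>\<^bsub>M\<^esub> x, \<ominus>\<^bsub>N\<^esub> y)"]) (auto simp: direct_sum_simps M.l_neg N.l_neg)
  qed (auto simp: direct_sum_simps M.a_ac N.a_ac)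
  then show ?thesis
    by (rule left_module.intro, intro left_module_axioms.intro)
       (auto simp: direct_sum_simps M.smult_closed M.smult_l_distr M.smult_r_distr M.smult_assoc
          M.smult_one N.smult_closed N.smult_l_distr N.smult_r_distr N.smult_assoc N.smult_one)
qed

lemma left_isomorphic_direct_sum:
  assumes "left_isomorphic M M'" "left_isomorphic N N'"
  shows "left_isomorphic (direct_sum M N) (direct_sum M' N')"
proof -
  obtain f g where f: "f \<in> left_hom M M'" "bij_betw f (carrier M) (carrier M')"
    and g: "g \<in> left_hom N N'" "bij_betw g (carrier N) (carrier N')"
    using assms unfolding left_isomorphic_def by blast
  have "map_prod f g \<in> left_hom (direct_sum M N) (direct_sum M' N')"
    using left_homD[OF f(1)] left_homD[OF g(1)] by (auto simp: left_hom_def direct_sum_simps)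
  moreover have "bij_betw (map_prod f g) (carrier (direct_sum M N)) (carrier (direct_sum M' N'))"
    unfolding direct_sum_simps using f(2) g(2) by (rule bij_betw_map_prod)
  ultimately show ?thesis unfolding left_isomorphic_def by blast
qed

lemma row_vec_mult_block_diag:
  fixes A B :: "'a::ring_1 mat"
  assumes "x \<in> carrier_vec (dim_row A)" "y \<in> carrier_vec (dim_row B)"
  shows "row_vec_mult (x @\<^sub>v y) (block_diag A B) = row_vec_mult x A @\<^sub>v row_vec_mult y B"
proof (rule eq_vecI)
  fix j assume "j < dim_vec (row_vec_mult x A @\<^sub>v row_vec_mult y B)"
  then have j: "j < dim_col A + dim_col B" by simp
  have "col (block_diag A B) j =
      (if j < dim_col A then col A j else 0\<^sub>v (dim_row A)) @\<^sub>v
      (if j < dim_col A then 0\<^sub>v (dim_row B) else col B (j - dim_col A))"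
    using j by (intro eq_vecI) (auto simp: block_diag_def)
  moreover have "(x @\<^sub>v y) \<bullet> (u @\<^sub>v v) = x \<bullet> u + y \<bullet> v"
    if "u \<in> carrier_vec (dim_row A)" "v \<in> carrier_vec (dim_row B)" for u v
    by (rule scalar_prod_append[OF assms that])
  ultimately show "row_vec_mult (x @\<^sub>v y) (block_diag A B) $ j =
      (row_vec_mult x A @\<^sub>v row_vec_mult y B) $ j"
    using j assms by auto
qed simp

text \<open>Concatenation of vectors is the isomorphism. It is what matches addition of modules with
  addition of matrices.\<close>

lemma direct_sum_row_module:
  fixes A B :: "'a::ring_1 mat"
  shows "left_isomorphic (direct_sum (row_module A) (row_module B)) (row_module (block_diag A B))"
proof -
  let ?h = "\<lambda>(x, y). x @\<^sub>v y :: 'a vec"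
  have dim: "x \<in> carrier_vec (dim_col A)" if "x \<in> carrier (row_module A)" for x and A :: "'a mat"
    using that by (auto simp: row_module_simps)
  have img: "?h ` (carrier (row_module A) \<times> carrier (row_module B)) = carrier (row_module (block_diag A B))"
  proof (intro equalityI subsetI)
    fix z assume "z \<in> ?h ` (carrier (row_module A) \<times> carrier (row_module B))"
    then obtain x y where xy: "x \<in> carrier_vec (dim_row A)" "y \<in> carrier_vec (dim_row B)"
      and z: "z = row_vec_mult x A @\<^sub>v row_vec_mult y B"
      by (auto simp: row_module_simps)
    then show "z \<in> carrier (row_module (block_diag A B))"
      using row_vec_mult_block_diag[OF xy] append_carrier_vec[OF xy]
      by (auto simp: row_module_simps intro!: exI[of _ "x @\<^sub>v y"])
  next
    fix z assume "z \<in> carrier (row_module (block_diag A B))"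
    then obtain w where w: "w \<in> carrier_vec (dim_row A + dim_row B)"
      and z: "z = row_vec_mult w (block_diag A B)"
      by (auto simp: row_module_simps)
    let ?x = "vec_first w (dim_row A)" and ?y = "vec_last w (dim_row B)"
    have xy: "?x \<in> carrier_vec (dim_row A)" "?y \<in> carrier_vec (dim_row B)" by auto
    have "z = row_vec_mult ?x A @\<^sub>v row_vec_mult ?y B"
      using z row_vec_mult_block_diag[OF xy] vec_first_last_append[OF w] by simp
    then show "z \<in> ?h ` (carrier (row_module A) \<times> carrier (row_module B))"
      using xy by (intro image_eqI[of _ _ "(row_vec_mult ?x A, row_vec_mult ?y B)"])
        (auto simp: row_module_simps)
  qed
  have "?h \<in> left_hom (direct_sum (row_module A) (row_module B)) (row_module (block_diag A B))"
  proof -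
    have "x @\<^sub>v y \<in> carrier (row_module (block_diag A B))"
      if "x \<in> carrier (row_module A)" "y \<in> carrier (row_module B)" for x y
      using img that by force
    moreover have "(x + x') @\<^sub>v (y + y') = (x @\<^sub>v y) + (x' @\<^sub>v y')"
      if "x \<in> carrier (row_module A)" "x' \<in> carrier (row_module A)"
        "y \<in> carrier (row_module B)" "y' \<in> carrier (row_module B)" for x x' y y'
      using append_vec_add[OF dim[OF that(1)] dim[OF that(2)] dim[OF that(3)] dim[OF that(4)]] by simp
    moreover have "(a \<cdot>\<^sub>v x) @\<^sub>v (a \<cdot>\<^sub>v y) = a \<cdot>\<^sub>v (x @\<^sub>v y)" for a and x y :: "'a vec"
      by (intro eq_vecI) auto
    ultimately show ?thesis
      by (auto simp: left_hom_def direct_sum_simps row_module_simps(2,4))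
  qed
  moreover have "inj_on ?h (carrier (direct_sum (row_module A) (row_module B)))"
    using append_vec_eq[OF dim dim] by (fastforce simp: inj_on_def direct_sum_simps)
  ultimately show ?thesis
    using img unfolding left_isomorphic_def bij_betw_def direct_sum_simps by blast
qed

section \<open>The isomorphism\<close>

lemma block_diag_rect:
  "A \<in> rect_mats \<Longrightarrow> B \<in> rect_mats \<Longrightarrow> block_diag A B \<in> rect_mats"
  by (simp add: rect_mats_def)

lemma zero_rect: "0\<^sub>m 1 1 \<in> rect_mats"
  by (simp add: rect_mats_def)

lemma one_rect: "n > 0 \<Longrightarrow> 1\<^sub>m n \<in> rect_mats"
  by (simp add: rect_mats_def)

text \<open>From \<open>A = A * 1 * 1\<close>; this bound makes the class of \<open>1\<close> an
  order-unit.\<close>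

lemma mat_le_one: "mat_le A (1\<^sub>m (dim_col A))"
  by (rule mat_leI[of A "dim_row A" "dim_col A" _ "dim_col A" "dim_col A" A "1\<^sub>m (dim_col A)"]) auto

text \<open>Both semigroups are indexed by matrices: \<open>cl A\<close> is the class of \<open>A\<close> in \<open>W_M\<close>, and the class of
  \<open>R\<^sup>n A\<close> in \<open>V_M\<close>.\<close>

locale matrix_classes =
  fixes G :: "'x po_monoid" (structure) and cl :: "'a::ring_1 mat \<Rightarrow> 'x"
  assumes carrier_eq: "carrier G = cl ` rect_mats"
    and cl_eq: "\<lbrakk>A \<in> rect_mats; B \<in> rect_mats\<rbrakk> \<Longrightarrow> cl A = cl B \<longleftrightarrow> mat_le A B \<and> mat_le B A"
    and cl_mult: "\<lbrakk>A \<in> rect_mats; B \<in> rect_mats\<rbrakk> \<Longrightarrow> cl A \<otimes> cl B = cl (block_diag A B)"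
    and cl_le: "\<lbrakk>A \<in> rect_mats; B \<in> rect_mats\<rbrakk> \<Longrightarrow> po_le G (cl A) (cl B) \<longleftrightarrow> mat_le A B"
    and one_eq: "\<one> = cl (0\<^sub>m 1 1)"
    and unit_eq: "po_unit G = cl (1\<^sub>m 1)"
begin

lemma comm_monoid_G: "comm_monoid G"
proof (rule comm_monoidI)
  fix x y assume "x \<in> carrier G" "y \<in> carrier G"
  then show "x \<otimes> y \<in> carrier G"
    by (auto simp: carrier_eq cl_mult block_diag_rect)
next
  show "\<one> \<in> carrier G" unfolding carrier_eq one_eq by (rule imageI[OF zero_rect])
next
  fix x y z assume "x \<in> carrier G" "y \<in> carrier G" "z \<in> carrier G"
  then show "x \<otimes> y \<otimes> z = x \<otimes> (y \<otimes> z)"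
    by (auto simp: carrier_eq cl_mult block_diag_rect block_diag_assoc)
next
  fix x assume "x \<in> carrier G"
  then obtain A where A: "A \<in> rect_mats" and x: "x = cl A"
    by (auto simp: carrier_eq)
  \<comment> \<open>The zero block stands in front here, so it is first moved behind
    \<open>A\<close> by the block swap and then cut off.\<close>
  show "\<one> \<otimes> x = x"
    unfolding x one_eq cl_mult[OF zero_rect A]
      cl_eq[OF block_diag_rect[OF zero_rect A] A]
    by (rule conjI[OF mat_le_trans[OF block_diag_commute_le block_diag_zero_le(1)]
          mat_le_trans[OF block_diag_zero_le(2) block_diag_commute_le]])
next
  fix x y assume "x \<in> carrier G" "y \<in> carrier G"
  then show "x \<otimes> y = y \<otimes> x"
    by (auto simp: carrier_eq cl_mult cl_eq block_diag_rect block_diag_commute_le)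
qed

text \<open>Exponents start at one because the zeroth power is the class of
  \<open>0\<^sub>m 1 1\<close>: the empty identity matrix is not in
  \<open>rect_mats\<close>.\<close>

lemma unit_pow: "po_unit G [^] Suc n = cl (1\<^sub>m (Suc n))"
proof (induction n)
  interpret comm_monoid G by (rule comm_monoid_G)
  case 0
  have "cl (1\<^sub>m 1) \<in> carrier G" by (simp add: carrier_eq one_rect)
  then show ?case by (simp add: unit_eq)
next
  interpret comm_monoid G by (rule comm_monoid_G)
  case (Suc n)
  have "po_unit G [^] Suc (Suc n) = po_unit G [^] Suc n \<otimes> po_unit G"
    by (rule nat_pow_Suc)
  also have "\<dots> = cl (block_diag (1\<^sub>m (Suc n)) (1\<^sub>m 1))"
    unfolding Suc.IH unfolding unit_eq by (intro cl_mult one_rect) auto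
  also have "\<dots> = cl (1\<^sub>m (Suc (Suc n)))"
    by (simp only: block_diag_one Suc_eq_plus1)
  finally show ?case .
qed

lemma po_comm_monoid_G: "po_comm_monoid G"
proof (intro po_comm_monoid.intro comm_monoid_G po_comm_monoid_axioms.intro)
  show "partial_order_on (carrier G) {(x, y). x \<in> carrier G \<and> y \<in> carrier G \<and> po_le G x y}"
    unfolding partial_order_on_def preorder_on_def
  proof (intro conjI)
    show "refl_on (carrier G) {(x, y). x \<in> carrier G \<and> y \<in> carrier G \<and> po_le G x y}"
      by (auto simp: refl_on_def carrier_eq cl_le mat_le_refl)
    show "trans {(x, y). x \<in> carrier G \<and> y \<in> carrier G \<and> po_le G x y}"
      by (rule transI) (auto simp: carrier_eq cl_le elim: mat_le_trans)
    show "antisym {(x, y). x \<in> carrier G \<and> y \<in> carrier G \<and> po_le G x y}"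
      by (rule antisymI) (auto simp: carrier_eq cl_le cl_eq)
  qed auto
next
  fix x y z assume "x \<in> carrier G" "y \<in> carrier G" "z \<in> carrier G" "po_le G x y"
  then show "po_le G (x \<otimes> z) (y \<otimes> z)"
    by (auto simp: carrier_eq cl_mult cl_le block_diag_rect intro!: block_diag_mono mat_le_refl)
next
  show "po_unit G \<in> carrier G" by (simp add: carrier_eq unit_eq one_rect)
next
  fix x assume "x \<in> carrier G"
  then obtain A where A: "A \<in> rect_mats" and x: "x = cl A"
    by (auto simp: carrier_eq)
  then obtain n where n: "dim_col A = Suc n"
    by (cases "dim_col A") (auto simp: rect_mats_def)
  have "po_le G x (po_unit G [^] Suc n)"
    unfolding x unit_pow cl_le[OF A one_rect[OF zero_less_Suc]] using mat_le_one[of A] n by simp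
  then show "\<exists>n::nat. po_le G x (po_unit G [^] n)" ..
qed

end

text \<open>Equality, order and sum of classes are decided by the same conditions on matrices in
  both monoids, so a map respecting the indexing is automatically injective, surjective, additive
  and order reflecting.\<close>

lemma matrix_classes_iso:
  fixes cl :: "'a::ring_1 mat \<Rightarrow> 'x" and cl' :: "'a mat \<Rightarrow> 'y"
  assumes G: "matrix_classes G cl" and H: "matrix_classes H cl'"
    and h: "\<And>A. A \<in> rect_mats \<Longrightarrow> h (cl A) = cl' A"
  shows "po_comm_monoid_iso G H h"
proof -
  interpret G: matrix_classes G cl by fact
  interpret H: matrix_classes H cl' by fact
  have "bij_betw h (carrier G) (carrier H)"
    unfolding G.carrier_eq H.carrier_eq
    by (auto simp: bij_betw_def inj_on_def h H.cl_eq G.cl_eq image_image)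
  moreover have "h \<in> hom G H"
    by (rule homI)
       (auto simp: G.carrier_eq H.carrier_eq h G.cl_mult H.cl_mult block_diag_rect)
  ultimately have "h \<in> iso G H" by (simp add: iso_def)
  then show ?thesis
    by (intro po_comm_monoid_iso.intro po_comm_monoid_iso_axioms.intro G.po_comm_monoid_G
        H.po_comm_monoid_G)
       (auto simp: G.carrier_eq h G.cl_le H.cl_le G.one_eq H.one_eq G.unit_eq H.unit_eq
          zero_rect one_rect simp del: One_nat_def)
qed

section \<open>The two semigroups as monoids indexed by matrices\<close>

lemma mat_class_eq_le:
  fixes A :: "'a::ring_1 mat"
  assumes R: "von_neumann_regular TYPE('a)" and A: "A \<in> rect_mats"
  shows "mat_class A = {B \<in> rect_mats. mat_le A B \<and> mat_le B A}"
  using A mat_preceq_iff[OF R] by (auto simp: mat_class_def mat_equiv_def)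

lemma mod_class_eqI:
  fixes M :: "('a::ring_1, 'b, 'm) module_scheme" and N :: "('a, 'c, 'n) module_scheme"
  assumes R: "von_neumann_regular TYPE('a)" and M: "fin_presented M" and N: "fin_presented N"
    and MN: "module_retract M N" and NM: "module_retract N M"
  shows "mod_class M = mod_class N"
  unfolding mod_class_eq_retract[OF R M] mod_class_eq_retract[OF R N]
  using module_retract_trans[OF MN] module_retract_trans[OF NM] module_retract_trans[OF _ MN]
    module_retract_trans[OF _ NM]
  by blast

text \<open>Both additions are unions over representatives; once the class does not depend on them,
  the union is that class.\<close>

lemma UN_UN_constant:
  assumes "X \<noteq> {}" "Y \<noteq> {}" "\<And>x y. x \<in> X \<Longrightarrow> y \<in> Y \<Longrightarrow> f x y = c"
  shows "(\<Union>x\<in>X. \<Union>y\<in>Y. f x y) = c"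
  using assms by auto

lemma matrix_classes_W_M:
  assumes R: "von_neumann_regular TYPE('a::ring_1)"
  shows "matrix_classes (W_M :: 'a mat set po_monoid) mat_class"
proof
  note cl = mat_class_eq_le[OF R]
  have eq: "mat_class A = mat_class B \<longleftrightarrow> mat_le A B \<and> mat_le B A"
    if "A \<in> rect_mats" "B \<in> rect_mats" for A B :: "'a mat"
  proof
    assume "mat_class A = mat_class B"
    then have "A \<in> mat_class B" using cl[OF that(1)] that(1) mat_le_refl by blast
    then show "mat_le A B \<and> mat_le B A" using cl[OF that(2)] by blast
  next
    assume "mat_le A B \<and> mat_le B A"
    then show "mat_class A = mat_class B"
      unfolding cl[OF that(1)] cl[OF that(2)] by (blast intro: mat_le_trans)
  qed
  show "carrier W_M = mat_class ` (rect_mats :: 'a mat set)"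
    by (auto simp: W_M_def quotient_def mat_class_def)
  fix A B :: "'a mat" assume A: "A \<in> rect_mats" and B: "B \<in> rect_mats"
  show "mat_class A = mat_class B \<longleftrightarrow> mat_le A B \<and> mat_le B A" by (rule eq[OF A B])
  have "(\<Union>A'\<in>mat_class A. \<Union>B'\<in>mat_class B. mat_class (block_diag A' B'))
      = mat_class (block_diag A B)"
  proof (rule UN_UN_constant)
    show "mat_class A \<noteq> {}" "mat_class B \<noteq> {}"
      using cl[OF A] cl[OF B] A B mat_le_refl by blast+
    fix A' B' assume "A' \<in> mat_class A" "B' \<in> mat_class B"
    then have "A' \<in> rect_mats" "B' \<in> rect_mats" "mat_le A A'" "mat_le A' A" "mat_le B B'" "mat_le B' B"
      using cl[OF A] cl[OF B] by auto
    then show "mat_class (block_diag A' B') = mat_class (block_diag A B)"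
      using eq[OF block_diag_rect block_diag_rect, of A' B' A B] A B by (simp add: block_diag_mono)
  qed
  then show "mat_class A \<otimes>\<^bsub>W_M\<^esub> mat_class B = mat_class (block_diag A B)"
    by (simp add: W_M_def)
  show "po_le W_M (mat_class A) (mat_class B) \<longleftrightarrow> mat_le A B"
  proof
    assume "po_le W_M (mat_class A) (mat_class B)"
    then obtain A' B' where A': "A' \<in> mat_class A" and B': "B' \<in> mat_class B" and "mat_preceq A' B'"
      by (auto simp: W_M_def)
    then have "mat_le A A'" "mat_le A' B'" "mat_le B' B"
      using cl[OF A] cl[OF B] mat_preceq_iff[OF R, of A' B'] by auto
    then show "mat_le A B" by (blast intro: mat_le_trans)
  next
    assume "mat_le A B"
    then have "mat_preceq A B" using mat_preceq_iff[OF R A B] by simp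
    moreover have "A \<in> mat_class A" "B \<in> mat_class B"
      using cl[OF A] cl[OF B] A B mat_le_refl by blast+
    ultimately show "po_le W_M (mat_class A) (mat_class B)" by (auto simp: W_M_def)
  qed
qed (simp_all add: W_M_def)

text \<open>The idempotent found for \<open>M\<close> may be empty and thus outside
  \<open>rect_mats\<close>; its row space is then zero, as is that of the zero matrix with one
  entry.\<close>

lemma fin_presented_rect_row_module:
  fixes M :: "('a::ring_1, 'b, 'm) module_scheme"
  assumes R: "von_neumann_regular TYPE('a)" and M: "fin_presented M"
  obtains A :: "'a mat" where "A \<in> rect_mats" "left_isomorphic (row_module A) M"
proof -
  obtain m and E :: "'a mat" where E: "E \<in> carrier_mat m m"
    and iso: "left_isomorphic (row_module E) M"
    using fin_presented_row_module[OF R M] by metis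
  show thesis
  proof (cases "m = 0")
    case True
    have trivial: "carrier (row_module A) = {\<zero>\<^bsub>row_module A\<^esub>}"
      if "\<And>x. row_vec_mult x A = 0\<^sub>v (dim_col A)" for A :: "'a mat"
      using that by (auto simp: row_module_simps intro!: exI[of _ "0\<^sub>v (dim_row A)"])
    have "left_isomorphic (row_module (0\<^sub>m 1 1 :: 'a mat)) (row_module E)"
      using True E
      by (intro left_isomorphic_trivial left_module_row_module trivial eq_vecI)
         (auto simp: scalar_prod_def)
    from zero_rect left_isomorphic_trans[OF this iso] show thesis by (rule that)
  next
    case False
    then have "E \<in> rect_mats" using E by (auto simp: rect_mats_def)
    then show thesis using iso by (rule that)
  qed
qed

text \<open>Retract equivalence says nothing directly about direct sums. Their compatibility is
  imported from matrices: arbitrary representatives are replaced by isomorphic row spaces, and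
  \<open>block_diag_mono\<close> applies.\<close>

lemma matrix_classes_V_M:
  assumes R: "von_neumann_regular TYPE('a::ring_1)"
  shows "matrix_classes (V_M :: ('a, 'a vec) module set po_monoid) (\<lambda>A. mod_class (row_module A))"
proof
  let ?cl = "\<lambda>A :: 'a mat. mod_class (row_module A)"
  have cl: "?cl A = {N \<in> fp_mods. module_retract (row_module A) N \<and> module_retract N (row_module A)}"
    for A by (rule mod_class_eq_retract[OF R row_module_fin_presented[OF R]])
  have fp: "row_module A \<in> fp_mods" for A :: "'a mat"
    using row_module_fin_presented[OF R] by (simp add: fp_mods_def)
  have self: "row_module A \<in> ?cl A" for A
    using cl fp module_retract_refl by blast
  note retract_iff = row_module_retract_iff[OF R]
  have eq: "?cl A = ?cl B \<longleftrightarrow> mat_le A B \<and> mat_le B A" for A B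
  proof
    assume "?cl A = ?cl B"
    then have "row_module A \<in> ?cl B" using self by blast
    then show "mat_le A B \<and> mat_le B A" using cl retract_iff by blast
  next
    assume "mat_le A B \<and> mat_le B A"
    then show "?cl A = ?cl B"
      using retract_iff by (intro mod_class_eqI[OF R] row_module_fin_presented[OF R]) blast+
  qed
  have repr: "\<exists>A\<in>rect_mats. left_isomorphic (row_module A) M" if "M \<in> fp_mods"
    for M :: "('a, 'a vec) module"
    using fin_presented_rect_row_module[OF R, of M] that unfolding fp_mods_def by blast
  have lm: "left_module M" if "M \<in> fp_mods" for M :: "('a, 'a vec) module"
    using that by (simp add: fp_mods_def fin_presented_def)
  have "mod_equiv `` {M} \<in> ?cl ` rect_mats" if M: "M \<in> fp_mods" for M
  proof -
    obtain A where A: "A \<in> rect_mats" "left_isomorphic (row_module A) M" using repr[OF M] by blast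
    then show ?thesis
      using mod_class_cong[OF left_module_row_module lm[OF M]] mod_class_fp_mods[OF M]
      by (metis imageI)
  qed
  moreover have "?cl A \<in> fp_mods // mod_equiv" for A
    unfolding mod_class_fp_mods[OF fp] by (rule quotientI[OF fp])
  ultimately show "carrier V_M = ?cl ` rect_mats"
    by (auto simp: V_M_def elim!: quotientE)
  fix A B :: "'a mat" assume A: "A \<in> rect_mats" and B: "B \<in> rect_mats"
  show "?cl A = ?cl B \<longleftrightarrow> mat_le A B \<and> mat_le B A" by (rule eq)
  have "(\<Union>M\<in>?cl A. \<Union>N\<in>?cl B. mod_class (direct_sum M N)) = ?cl (block_diag A B)"
  proof (rule UN_UN_constant)
    show "?cl A \<noteq> {}" "?cl B \<noteq> {}" using self by blast+
    fix M N assume M: "M \<in> ?cl A" and N: "N \<in> ?cl B"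
    have fpMN: "M \<in> fp_mods" "N \<in> fp_mods" using M N cl by blast+
    \<comment> \<open>\<open>M\<close> is only a mutual retract of the row space of
      \<open>A\<close>, so it needs its own matrix \<open>A'\<close>; equality of classes then makes
      \<open>A'\<close> and \<open>A\<close> equivalent.\<close>
    obtain A' where A': "left_isomorphic (row_module A') M" using repr[OF fpMN(1)] by blast
    obtain B' where B': "left_isomorphic (row_module B') N" using repr[OF fpMN(2)] by blast
    have "?cl A = mod_class M" if "M \<in> ?cl A" for A M
    proof -
      have "fin_presented M" "module_retract (row_module A) M" "module_retract M (row_module A)"
        using that cl fp_mods_def by blast+
      then show ?thesis by (rule mod_class_eqI[OF R row_module_fin_presented[OF R]])
    qed
    note this[OF M] this[OF N]
    then have "?cl A' = ?cl A" "?cl B' = ?cl B"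
      using mod_class_cong[OF left_module_row_module lm[OF fpMN(1)] A']
        mod_class_cong[OF left_module_row_module lm[OF fpMN(2)] B'] by simp_all
    then have "mat_le A' A" "mat_le A A'" "mat_le B' B" "mat_le B B'"
      using eq by blast+
    then have "?cl (block_diag A' B') = ?cl (block_diag A B)"
      using eq block_diag_mono by blast
    moreover have "mod_class (direct_sum M N) = mod_class (direct_sum (row_module A') (row_module B'))"
      by (rule mod_class_cong[symmetric, OF _ _ left_isomorphic_direct_sum[OF A' B']])
         (intro left_module_direct_sum left_module_row_module lm fpMN)+
    moreover have "\<dots> = ?cl (block_diag A' B')"
      by (rule mod_class_cong[OF _ _ direct_sum_row_module])
         (intro left_module_direct_sum left_module_row_module)+
    ultimately show "mod_class (direct_sum M N) = ?cl (block_diag A B)" by simp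
  qed
  then show "?cl A \<otimes>\<^bsub>V_M\<^esub> ?cl B = ?cl (block_diag A B)"
    by (simp add: V_M_def)
  show "po_le V_M (?cl A) (?cl B) \<longleftrightarrow> mat_le A B"
  proof
    assume "po_le V_M (?cl A) (?cl B)"
    then obtain M N where M: "M \<in> ?cl A" and N: "N \<in> ?cl B" and "mod_preceq M N"
      by (auto simp: V_M_def)
    then have "module_retract (row_module A) M" "module_retract M N" "module_retract N (row_module B)"
      using cl mod_preceq_iff[OF R, of M N] by blast+
    then have "module_retract (row_module A) (row_module B)"
      using module_retract_trans by metis
    then show "mat_le A B" by (simp add: retract_iff)
  next
    assume "mat_le A B"
    then have "mod_preceq (row_module A) (row_module B)"
      using mod_preceq_iff[OF R fp fp] retract_iff by blast
    then show "po_le V_M (?cl A) (?cl B)"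
      using self by (auto simp: V_M_def)
  qed
next
  have "left_module zero_module"
    by (intro left_module.intro abelian_groupI left_module_axioms.intro) (auto simp: zero_module_def)
  moreover have "row_vec_mult x (0\<^sub>m 1 1) = (0\<^sub>v 1 :: 'a vec)" for x
    by (intro eq_vecI) (auto simp: scalar_prod_def)
  then have "carrier (row_module (0\<^sub>m 1 1 :: 'a mat)) = {\<zero>\<^bsub>row_module (0\<^sub>m 1 1 :: 'a mat)\<^esub>}"
    by (auto simp: row_module_simps intro!: exI[of _ "0\<^sub>v 1"])
  ultimately have "mod_class (zero_module :: ('a, unit) module) = mod_class (row_module (0\<^sub>m 1 1))"
    by (intro mod_class_cong left_isomorphic_trivial left_module_row_module)
       (auto simp: zero_module_def)
  then show "\<one>\<^bsub>V_M\<^esub> = mod_class (row_module (0\<^sub>m 1 1 :: 'a mat))"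
    by (simp add: V_M_def)
next
  let ?I = "1\<^sub>m 1 :: 'a mat"
  have "left_module (regular_module :: ('a, 'a) module)"
  proof (intro left_module.intro abelian_groupI left_module_axioms.intro)
    fix x :: 'a
    show "\<exists>y\<in>carrier regular_module. y \<oplus>\<^bsub>regular_module\<^esub> x = \<zero>\<^bsub>regular_module\<^esub>"
      by (intro bexI[of _ "- x"]) (auto simp: regular_module_def)
  qed (auto simp: regular_module_def algebra_simps)
  moreover have "left_isomorphic (row_module ?I) (regular_module :: ('a, 'a) module)"
  proof -
    \<comment> \<open>The row space of the identity consists of all vectors of length one, which the
      coordinate at \<open>0\<close> identifies with the ring.\<close>
    have car: "carrier (row_module ?I) = carrier_vec 1"
      by (force simp: row_module_simps row_vec_mult_one simp del: One_nat_def)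
    have "(\<lambda>x. x $ 0) \<in> left_hom (row_module ?I) (regular_module :: ('a, 'a) module)"
      unfolding left_hom_def car by (auto simp: row_module_simps(2,4) regular_module_def)
    moreover have "bij_betw (\<lambda>x. x $ 0) (carrier_vec 1) (UNIV :: 'a set)"
      by (rule bij_betwI[where g = "\<lambda>a. vec 1 (\<lambda>_. a)"]) auto
    ultimately show ?thesis
      unfolding left_isomorphic_def car by (auto simp: regular_module_def)
  qed
  ultimately have "mod_class (regular_module :: ('a, 'a) module) = mod_class (row_module ?I)"
    by (intro mod_class_cong[symmetric] left_module_row_module)
  then show "po_unit V_M = mod_class (row_module ?I)"
    by (simp add: V_M_def)
qed

theorem theorem6p7:
  assumes "von_neumann_regular TYPE('a::ring_1)"
  shows "\<exists>\<Psi> :: 'a mat set \<Rightarrow> ('a, 'a vec) module set.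
    po_comm_monoid_iso W_M V_M \<Psi> \<and>
    (\<forall>n>0. \<forall>m>0. \<forall>A\<in>carrier_mat n m. \<Psi> (mat_class A) = mod_class (row_module A))"
proof -
  note W = matrix_classes_W_M[OF assms] and V = matrix_classes_V_M[OF assms]
  \<comment> \<open>The union avoids choosing a matrix from the class: all its members contribute
    the same module class.\<close>
  define \<Psi> :: "'a mat set \<Rightarrow> ('a, 'a vec) module set"
    where "\<Psi> X = (\<Union>A\<in>X. mod_class (row_module A))" for X
  have \<Psi>: "\<Psi> (mat_class A) = mod_class (row_module A)" if A: "A \<in> rect_mats" for A
  proof -
    have "mod_class (row_module B) = mod_class (row_module A)" if "B \<in> mat_class A" for B
      using that mat_class_eq_le[OF assms A] matrix_classes.cl_eq[OF V _ A, of B] by simp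
    moreover have "A \<in> mat_class A"
      using mat_class_eq_le[OF assms A] A mat_le_refl by blast
    ultimately show ?thesis unfolding \<Psi>_def by blast
  qed
  have "A \<in> rect_mats" if "n > 0" "m > 0" "A \<in> carrier_mat n m" for n m and A :: "'a mat"
    using that by (auto simp: rect_mats_def)
  with \<Psi> matrix_classes_iso[OF W V \<Psi>] show ?thesis by blast
qed

end
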